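(* Let $\varphi\in\operatorname{LFM}(B_2)$ be parabolic. Then: (1) $(\varphi,B_2)$ is conjugated to $(\psi_1,\mathbb{H}^2)$, or $(\psi_2,\mathbb{H}^2)$, or $(\psi_3,\mathbb{H}^2)$, where $$\psi_1(u_1,u_2)=(u_1+2ibu_2+c,\ \lambda u_2),$$ $$\psi_2(u_1,u_2)=(u_1+c,\ e^{i\theta}u_2),$$ $$\psi_3(u_1,u_2)=(u_1+2i\bar{a}u_2+c,\ u_2+a),$$ for some specific $a,b,c\in\mathbb{C}$, $\theta\in\mathbb{R}$ and $\lambda\in\mathbb{C}$ with $|\lambda|\in(0,1)$. (2) Let $\lambda=\exp(-\mu+iv)$ where $\mu>0$ and $v\in[0,2\pi)$. If $$\operatorname{Im}c\ge\frac{|b|^2(\mu^2+v^2)}{\mu|1-\lambda|^2},$$ then $\psi_1$ can be embedded into a semigroup of $\mathbb{H}^2$. The maps $\psi_2$ and $\psi_3$ can always be embedded into a semigroup on $\mathbb{H}^2$.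
   Context: $B_N$ is the open unit ball of $\mathbb{C}^N$ and $\mathbb{H}^N=\{(u_1,u')\in\mathbb{C}\times\mathbb{C}^{N-1}:\operatorname{Im}u_1>|u'|^2\}$ the Siegel half-plane, biholomorphic to $B_N$. The maps $\psi_1,\psi_2,\psi_3$ are understood to be self-maps of $\mathbb{H}^2$. A holomorphic map is linear fractional if it has the form $z\mapsto \frac{Az+B}{\langle z,C\rangle+D}$ with $A\in\mathbb{C}^{N\times N}$, $B,C\in\mathbb{C}^N$, $D\in\mathbb{C}$; $\operatorname{LFM}(B_N)$ is the set of linear fractional self-maps of $B_N$. If a holomorphic self-map $\varphi$ of $B_N$ has no fixed point in $B_N$, its iterates converge locally uniformly to a unique point $w\in\partial B_N$ (the Denjoy-Wolff point), and $\liminf_{z\to w}\frac{1-|\varphi(z)|^2}{1-|z|^2}=\delta\in(0,1]$ is its boundary dilation coefficient; $\varphi$ is parabolic if it has no fixed point in $B_N$ and $\delta=1$. For holomorphic self-maps $\psi:D\to D$ and $\psi':D'\to D'$ of domains in $\mathbb{C}^N$, $(\psi,D)$ and $(\psi',D')$ are conjugated if there is a biholomorphic map $\sigma:D\to D'$ with $\psi=\sigma^{-1}\circ\psi'\circ\sigma$. A (continuous) semigroup $\{\varphi_t\}_{t\ge0}$ on a domain $D$ is a continuous homomorphism from the additive semigroup of non-negative reals into the composition semigroup of holomorphic self-maps of $D$ with the compact-open topology (so $\varphi_0=\mathrm{id}$, $\varphi_{t+s}=\varphi_t\circ\varphi_s$). A self-map $\varphi$ of $D$ can be embedded into a semigroup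 on $D$ if there is a semigroup $\{\varphi_t\}$ on $D$ with $\varphi_1=\varphi$.
   Formalization: Part (1) is false for non-injective φ, e.g. (u1,u2)↦(u1+1,0) on the Siegel half-plane; so for non-injective φ only, a fourth alternative is added: φ is conjugated to ψ1 with λ=0. *)

theory Defs
  imports "HOL-Analysis.Analysis"
begin

section \<open>Holomorphic maps in several variables\<close>

text \<open>Only used for open \<open>D\<close>. Maps are total functions whose values off \<open>D\<close> are irrelevant.\<close>

definition holomorphic_map :: "(complex^'n \<Rightarrow> complex^'m) \<Rightarrow> (complex^'n) set \<Rightarrow> bool" where
  "holomorphic_map f D \<longleftrightarrow>
     (\<forall>z\<in>D. \<exists>L. (f has_derivative L) (at z) \<and> (\<forall>c v. L (c *s v) = c *s L v))"

definition holomorphic_self_map :: "(complex^'n \<Rightarrow> complex^'n) \<Rightarrow> (complex^'n) set \<Rightarrow> bool" where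
  "holomorphic_self_map f D \<longleftrightarrow> holomorphic_map f D \<and> f ` D \<subseteq> D"

definition biholomorphic_map ::
  "(complex^'n \<Rightarrow> complex^'n) \<Rightarrow> (complex^'n) set \<Rightarrow> (complex^'n) set \<Rightarrow> bool" where
  "biholomorphic_map \<sigma> D D' \<longleftrightarrow>
     bij_betw \<sigma> D D' \<and> holomorphic_map \<sigma> D \<and> holomorphic_map (inv_into D \<sigma>) D'"

definition conjugated ::
  "(complex^'n \<Rightarrow> complex^'n) \<Rightarrow> (complex^'n) set \<Rightarrow>
   (complex^'n \<Rightarrow> complex^'n) \<Rightarrow> (complex^'n) set \<Rightarrow> bool" where
  "conjugated \<psi> D \<psi>' D' \<longleftrightarrow>
     holomorphic_self_map \<psi> D \<and> holomorphic_self_map \<psi>' D' \<and>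
     (\<exists>\<sigma>. biholomorphic_map \<sigma> D D' \<and> (\<forall>z\<in>D. \<psi> z = inv_into D \<sigma> (\<psi>' (\<sigma> z))))"

section \<open>Linear fractional and parabolic self-maps of the ball\<close>

abbreviation unit_ball :: "(complex^'n) set" where
  "unit_ball \<equiv> ball 0 1"

definition hermitian_inner :: "complex^'n \<Rightarrow> complex^'n \<Rightarrow> complex" where
  "hermitian_inner z w = (\<Sum>i\<in>UNIV. z $ i * cnj (w $ i))"

text \<open>The denominator has to be required to be nonzero because division by zero is total in HOL.\<close>

definition LFM :: "(complex^'n \<Rightarrow> complex^'n) set" where
  "LFM = {\<phi>. (\<exists>(A :: complex^'n^'n) B C D. \<forall>z\<in>unit_ball.
                hermitian_inner z C + D \<noteq> 0 \<and>
                \<phi> z = inverse (hermitian_inner z C + D) *s (A *v z + B))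
            \<and> \<phi> ` unit_ball \<subseteq> unit_ball}"

definition denjoy_wolff_point :: "(complex^'n \<Rightarrow> complex^'n) \<Rightarrow> complex^'n \<Rightarrow> bool" where
  "denjoy_wolff_point \<phi> w \<longleftrightarrow> w \<in> sphere 0 1 \<and>
     (\<forall>K. compact K \<and> K \<subseteq> unit_ball \<longrightarrow>
        uniform_limit K (\<lambda>n. \<phi> ^^ n) (\<lambda>_. w) sequentially)"

definition boundary_dilation :: "(complex^'n \<Rightarrow> complex^'n) \<Rightarrow> complex^'n \<Rightarrow> ereal" where
  "boundary_dilation \<phi> w =
     Liminf (at w within unit_ball) (\<lambda>z. ereal ((1 - (norm (\<phi> z))\<^sup>2) / (1 - (norm z)\<^sup>2)))"

definition parabolic :: "(complex^'n \<Rightarrow> complex^'n) \<Rightarrow> bool" where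
  "parabolic \<phi> \<longleftrightarrow>
     holomorphic_self_map \<phi> unit_ball \<and> (\<forall>z\<in>unit_ball. \<phi> z \<noteq> z) \<and>
     (\<exists>w. denjoy_wolff_point \<phi> w \<and> boundary_dilation \<phi> w = 1)"

section \<open>Continuous semigroups\<close>

text \<open>The compact-open topology for maps on \<open>D\<close>; since it is put on total functions, it does not
  separate functions that agree on \<open>D\<close>.\<close>

definition compact_open_topology :: "(complex^'n) set \<Rightarrow> (complex^'n \<Rightarrow> complex^'n) topology" where
  "compact_open_topology D =
     topology_generated_by {{f. f ` K \<subseteq> U} | K U. compact K \<and> K \<subseteq> D \<and> open U}"

definition continuous_semigroup ::
  "(real \<Rightarrow> complex^'n \<Rightarrow> complex^'n) \<Rightarrow> (complex^'n) set \<Rightarrow> bool" where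
  "continuous_semigroup \<Phi> D \<longleftrightarrow>
     (\<forall>t\<ge>0. holomorphic_self_map (\<Phi> t) D) \<and>
     (\<forall>z\<in>D. \<Phi> 0 z = z) \<and>
     (\<forall>s\<ge>0. \<forall>t\<ge>0. \<forall>z\<in>D. \<Phi> (t + s) z = \<Phi> t (\<Phi> s z)) \<and>
     continuous_map (top_of_set {0..}) (compact_open_topology D) \<Phi>"

definition embeddable :: "(complex^'n \<Rightarrow> complex^'n) \<Rightarrow> (complex^'n) set \<Rightarrow> bool" where
  "embeddable \<phi> D \<longleftrightarrow> (\<exists>\<Phi>. continuous_semigroup \<Phi> D \<and> (\<forall>z\<in>D. \<Phi> 1 z = \<phi> z))"

section \<open>The Siegel half-plane and the model maps\<close>

definition siegel :: "(complex^2) set" where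
  "siegel = {u. Im (u $ 1) > (cmod (u $ 2))\<^sup>2}"

definition psi1 :: "complex \<Rightarrow> complex \<Rightarrow> complex \<Rightarrow> complex^2 \<Rightarrow> complex^2" where
  "psi1 b c l u = vector [u $ 1 + 2 * \<i> * b * u $ 2 + c, l * u $ 2]"

definition psi2 :: "complex \<Rightarrow> real \<Rightarrow> complex^2 \<Rightarrow> complex^2" where
  "psi2 c \<theta> u = vector [u $ 1 + c, exp (\<i> * of_real \<theta>) * u $ 2]"

definition psi3 :: "complex \<Rightarrow> complex \<Rightarrow> complex^2 \<Rightarrow> complex^2" where
  "psi3 a c u = vector [u $ 1 + 2 * \<i> * cnj a * u $ 2 + c, u $ 2 + a]"

text \<open>Degenerate case: the matrix defining an element of \<open>LFM\<close> may be singular. For example, the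
  map \<open>(u\<^sub>1, u\<^sub>2) \<mapsto> (u\<^sub>1 + 1, 0)\<close> of the Siegel half-plane comes from a parabolic linear fractional
  map of the ball. It is not injective, whereas \<open>psi2\<close>, \<open>psi3\<close> and \<open>psi1\<close> with \<open>l \<noteq> 0\<close> are.
  The classification of parabolic maps in \<open>LFM\<close> therefore has to admit \<open>psi1\<close> with \<open>l = 0\<close> for
  non-injective maps (and for these only).\<close>

end

theory Submission
  imports Defs
begin

text \<open>The Cayley transform sending the Denjoy--Wolff point \<open>w\<close> to infinity turns \<open>\<phi>\<close> into an affine map
  \<open>(u\<^sub>1, u\<^sub>2) \<mapsto> (\<alpha> u\<^sub>1 + \<beta> u\<^sub>2 + \<gamma>, \<delta> u\<^sub>2 + \<epsilon>)\<close>. Preserving the Siegel half-plane forces \<open>\<alpha> \<ge> 0\<close> and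
  \<open>\<bar>\<delta> v + \<epsilon>\<bar>\<^sup>2 \<le> \<alpha> \<bar>v\<bar>\<^sup>2 + Im (\<beta> v + \<gamma>)\<close> for all \<open>v\<close>, and the dilation coefficient \<open>1\<close> forces \<open>\<alpha> = 1\<close>.
  Then \<open>\<bar>\<delta>\<bar> \<le> 1\<close>, and a Heisenberg translation brings the map to one of the normal forms.

  The embedding semigroups are \<open>(u\<^sub>1 + \<beta>\<^sub>t u\<^sub>2 + \<kappa>\<^sub>t, \<delta>\<^sub>t u\<^sub>2 + \<epsilon>\<^sub>t)\<close>; for \<open>psi1\<close> with \<open>\<delta>\<^sub>t = e\<^bsup>t(-\<mu>+iv)\<^esup>\<close>,
  \<open>\<beta>\<^sub>t = 2 i b (1 - \<delta>\<^sub>t) / (1 - \<lambda>)\<close> and \<open>\<kappa>\<^sub>t = t c\<close>, the bound on \<open>Im c\<close> together with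
  \<open>\<mu> \<bar>1 - \<delta>\<^sub>t\<bar> \<le> \<bar>-\<mu>+iv\<bar> (1 - e\<^bsup>-\<mu>t\<^esup>)\<close> makes each of them preserve the half-plane.\<close>

section \<open>Holomorphic maps and conjugation\<close>

text \<open>Scalar and pointwise counterpart of \<open>holomorphic_map\<close>: closure under field
  operations is proved for single components, with nonvanishing of a denominator needed only at the
  point.\<close>

definition holomorphic_fun_at :: "(complex^'n \<Rightarrow> complex) \<Rightarrow> complex^'n \<Rightarrow> bool" where
  "holomorphic_fun_at f z \<longleftrightarrow>
     (\<exists>L. (f has_derivative L) (at z) \<and> (\<forall>c v. L (c *s v) = c * L v))"

lemma holomorphic_fun_at_const: "holomorphic_fun_at (\<lambda>z. k) z"
  unfolding holomorphic_fun_at_def by (intro exI[of _ "\<lambda>_. 0"]) auto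

lemma holomorphic_fun_at_nth: "holomorphic_fun_at (\<lambda>z. z $ i) z"
  unfolding holomorphic_fun_at_def
  by (intro exI[of _ "\<lambda>z. z $ i"]) (auto intro: bounded_linear_imp_has_derivative)

lemma holomorphic_fun_at_add:
  assumes "holomorphic_fun_at f z" "holomorphic_fun_at g z"
  shows "holomorphic_fun_at (\<lambda>z. f z + g z) z"
proof -
  from assms obtain L M where "(f has_derivative L) (at z)" "(g has_derivative M) (at z)"
    and "\<forall>c v. L (c *s v) = c * L v" "\<forall>c v. M (c *s v) = c * M v"
    unfolding holomorphic_fun_at_def by blast
  then show ?thesis
    unfolding holomorphic_fun_at_def
    by (intro exI[of _ "\<lambda>v. L v + M v"]) (auto intro: has_derivative_add simp: distrib_left)
qed

lemma holomorphic_fun_at_mult: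
  assumes "holomorphic_fun_at f z" "holomorphic_fun_at g z"
  shows "holomorphic_fun_at (\<lambda>z. f z * g z) z"
proof -
  from assms obtain L M where "(f has_derivative L) (at z)" "(g has_derivative M) (at z)"
    and "\<forall>c v. L (c *s v) = c * L v" "\<forall>c v. M (c *s v) = c * M v"
    unfolding holomorphic_fun_at_def by blast
  then show ?thesis
    unfolding holomorphic_fun_at_def
    by (intro exI[of _ "\<lambda>v. f z * M v + L v * g z"] conjI has_derivative_mult)
      (auto simp: algebra_simps)
qed

lemma holomorphic_fun_at_inverse:
  assumes "holomorphic_fun_at f z" "f z \<noteq> 0"
  shows "holomorphic_fun_at (\<lambda>z. inverse (f z)) z"
proof -
  from assms obtain L where "(f has_derivative L) (at z)" "\<forall>c v. L (c *s v) = c * L v"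
    unfolding holomorphic_fun_at_def by blast
  then show ?thesis
    unfolding holomorphic_fun_at_def using assms(2)
    by (intro exI[of _ "\<lambda>v. - (inverse (f z) * L v * inverse (f z))"])
      (auto intro: has_derivative_inverse)
qed

lemma holomorphic_fun_at_minus:
  "holomorphic_fun_at f z \<Longrightarrow> holomorphic_fun_at (\<lambda>z. - f z) z"
  using holomorphic_fun_at_mult[OF holomorphic_fun_at_const[of "-1"]] by simp

lemma holomorphic_fun_at_diff:
  "holomorphic_fun_at f z \<Longrightarrow> holomorphic_fun_at g z \<Longrightarrow> holomorphic_fun_at (\<lambda>z. f z - g z) z"
  using holomorphic_fun_at_add[OF _ holomorphic_fun_at_minus] by fastforce

lemma holomorphic_fun_at_divide:
  "holomorphic_fun_at f z \<Longrightarrow> holomorphic_fun_at g z \<Longrightarrow> g z \<noteq> 0 \<Longrightarrow>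
    holomorphic_fun_at (\<lambda>z. f z / g z) z"
  unfolding divide_inverse
  by (intro holomorphic_fun_at_mult holomorphic_fun_at_inverse)

lemmas holomorphic_fun_at_intros =
  holomorphic_fun_at_const holomorphic_fun_at_nth holomorphic_fun_at_add
  holomorphic_fun_at_diff holomorphic_fun_at_mult holomorphic_fun_at_divide

lemma bounded_linear_axis: "bounded_linear (axis i :: complex \<Rightarrow> complex^'n)"
  unfolding linear_conv_bounded_linear[symmetric]
  by (rule linearI) (auto simp: axis_def vec_eq_iff)

lemma vector_2_eta: "vector [z $ 1, z $ 2] = (z :: 'a::zero^2)"
  by (simp add: vec_eq_iff forall_2)

lemma vector_2_axis: "vector [x, y] = axis 1 x + (axis 2 y :: complex^2)"
  by (simp add: vec_eq_iff forall_2 axis_def)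

lemma holomorphic_map_vector_2:
  assumes "\<And>z. z \<in> D \<Longrightarrow> holomorphic_fun_at f z" "\<And>z. z \<in> D \<Longrightarrow> holomorphic_fun_at g z"
  shows "holomorphic_map (\<lambda>z. vector [f z, g z] :: complex^2) D"
  unfolding holomorphic_map_def
proof
  fix z assume "z \<in> D"
  with assms obtain L M where "(f has_derivative L) (at z)" "(g has_derivative M) (at z)"
    and "\<forall>c v. L (c *s v) = c * L v" "\<forall>c v. M (c *s v) = c * M v"
    unfolding holomorphic_fun_at_def by metis
  then show "\<exists>L. ((\<lambda>z. vector [f z, g z] :: complex^2) has_derivative L) (at z) \<and>
      (\<forall>c v. L (c *s v) = c *s L v)"
    unfolding vector_2_axis
    by (intro exI[of _ "\<lambda>v. axis 1 (L v) + axis 2 (M v)"] conjI has_derivative_add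
        bounded_linear.has_derivative[OF bounded_linear_axis])
      (auto simp: vec_eq_iff forall_2 axis_def)
qed

text \<open>Lets an explicit formula replace \<open>inv_into\<close>, with which it agrees on the
  domain only. Openness matters because the derivative is taken along full neighbourhoods.\<close>

lemma holomorphic_map_cong:
  assumes "holomorphic_map f D" "open D" "\<And>z. z \<in> D \<Longrightarrow> f z = g z"
  shows "holomorphic_map g D"
  unfolding holomorphic_map_def
proof
  fix z assume "z \<in> D"
  then obtain L where "(f has_derivative L) (at z)" "\<forall>c v. L (c *s v) = c *s L v"
    using assms(1) unfolding holomorphic_map_def by blast
  moreover from this have "(g has_derivative L) (at z)"
    using has_derivative_transform_within_open assms(2,3) \<open>z \<in> D\<close> by blast
  ultimately show "\<exists>L. (g has_derivative L) (at z) \<and> (\<forall>c v. L (c *s v) = c *s L v)"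
    by blast
qed

lemma holomorphic_map_compose:
  assumes "holomorphic_map f D" "holomorphic_map g D'" "\<And>z. z \<in> D \<Longrightarrow> f z \<in> D'"
  shows "holomorphic_map (\<lambda>z. g (f z)) D"
  unfolding holomorphic_map_def
proof
  fix z assume "z \<in> D"
  then obtain L M where L: "(f has_derivative L) (at z)" "\<forall>c v. L (c *s v) = c *s L v"
    and M: "(g has_derivative M) (at (f z))" "\<forall>c v. M (c *s v) = c *s M v"
    using assms unfolding holomorphic_map_def by blast
  then show "\<exists>L. ((\<lambda>z. g (f z)) has_derivative L) (at z) \<and> (\<forall>c v. L (c *s v) = c *s L v)"
    using has_derivative_compose[OF L(1) M(1)] by (intro exI[of _ "\<lambda>v. M (L v)"]) auto
qed

text \<open>Any two-sided inverse on the target may serve as the inverse, although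
  \<^const>\<open>biholomorphic_map\<close> refers to \<^const>\<open>inv_into\<close>.\<close>

lemma conjugatedI:
  assumes "open D'"
    and \<sigma>: "holomorphic_map \<sigma> D" "\<And>z. z \<in> D \<Longrightarrow> \<sigma> z \<in> D'"
    and \<tau>: "holomorphic_map \<tau> D'" "\<And>u. u \<in> D' \<Longrightarrow> \<tau> u \<in> D"
    and inv: "\<And>z. z \<in> D \<Longrightarrow> \<tau> (\<sigma> z) = z" "\<And>u. u \<in> D' \<Longrightarrow> \<sigma> (\<tau> u) = u"
    and \<phi>: "holomorphic_self_map \<phi> D"
    and \<psi>: "holomorphic_map \<psi> D'"
    and eq: "\<And>z. z \<in> D \<Longrightarrow> \<sigma> (\<phi> z) = \<psi> (\<sigma> z)"
  shows "conjugated \<phi> D \<psi> D'"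
proof -
  have \<phi>D: "\<phi> z \<in> D" if "z \<in> D" for z
    using \<phi> that unfolding holomorphic_self_map_def by blast
  have bij: "bij_betw \<sigma> D D'"
    by (rule bij_betwI[where g = \<tau>]) (use \<sigma> \<tau> inv in auto)
  have inv_eq: "inv_into D \<sigma> u = \<tau> u" if "u \<in> D'" for u
    using bij inv_into_f_eq[OF bij_betw_imp_inj_on[OF bij], of "\<tau> u" u] \<tau>(2) inv(2) that
    by blast
  have "holomorphic_map (inv_into D \<sigma>) D'"
    by (rule holomorphic_map_cong[OF \<tau>(1) assms(1)]) (simp add: inv_eq)
  moreover have "\<psi> u \<in> D'" if "u \<in> D'" for u
    using eq[of "\<tau> u"] \<sigma>(2)[OF \<phi>D[of "\<tau> u"]] \<tau>(2) inv(2) that by simp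
  moreover have "\<phi> z = inv_into D \<sigma> (\<psi> (\<sigma> z))" if "z \<in> D" for z
    using eq[OF that, symmetric] inv_eq[OF \<sigma>(2)[OF \<phi>D[OF that]]] inv(1)[OF \<phi>D[OF that]] by simp
  ultimately show ?thesis
    unfolding conjugated_def biholomorphic_map_def holomorphic_self_map_def[of \<psi>]
    using \<phi> \<psi> bij \<sigma>(1) by blast
qed

section \<open>Embedding the model maps\<close>

text \<open>Joint continuity suffices, by the tube lemma: if \<open>\<Phi> t\<close> maps the
  compact set \<open>K\<close> into \<open>U\<close>, then so does \<open>\<Phi> t'\<close> for all
  \<open>t'\<close> near \<open>t\<close>. Only subbasic sets need checking.\<close>

lemma continuous_map_compact_open:
  fixes \<Phi> :: "real \<Rightarrow> complex^'n \<Rightarrow> complex^'n"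
  assumes "continuous_on UNIV (\<lambda>(t, z). \<Phi> t z)"
  shows "continuous_map (top_of_set T) (compact_open_topology D) \<Phi>"
  unfolding compact_open_topology_def
proof (rule continuous_on_generated_topo)
  fix W :: "(complex^'n \<Rightarrow> complex^'n) set"
  assume "W \<in> {{f. f ` K \<subseteq> U} | K U. compact K \<and> K \<subseteq> D \<and> open U}"
  then obtain K U where W: "W = {f. f ` K \<subseteq> U}" "compact K" "open U" by blast
  have op: "open {(t, z). \<Phi> t z \<in> U}"
    using open_vimage[OF W(3) assms] by (simp add: vimage_def case_prod_unfold)
  have "open {t. \<Phi> t ` K \<subseteq> U}"
  proof (subst open_subopen, safe)
    fix t assume "\<Phi> t ` K \<subseteq> U"
    then have "{t} \<times> K \<subseteq> {(t, z). \<Phi> t z \<in> U}" by blast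
    from Elementary_Topology.tube_lemma[OF W(2) op this]
    obtain X where "t \<in> X" "open X" "X \<times> K \<subseteq> {(t, z). \<Phi> t z \<in> U}" by blast
    then show "\<exists>X. open X \<and> t \<in> X \<and> X \<subseteq> {t. \<Phi> t ` K \<subseteq> U}" by blast
  qed
  then show "openin (top_of_set T) (\<Phi> -` W \<inter> topspace (top_of_set T))"
    using W(1) by (simp add: vimage_def openin_open_Int Int_commute)
next
  \<comment> \<open>The carrier of the generated topology is the union of its generators; the empty
    compact set contributes every function.\<close>
  have "UNIV \<in> {{f. f ` K \<subseteq> U} | K U. compact K \<and> K \<subseteq> D \<and> open (U :: (complex^'n) set)}"
    by (intro CollectI exI[of _ "{}"] exI[of _ UNIV]) auto
  then show "\<Phi> ` topspace (top_of_set T) \<subseteq>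
      \<Union> {{f. f ` K \<subseteq> U} | K U. compact K \<and> K \<subseteq> D \<and> open U}"
    by blast
qed

section \<open>Affine semigroups on the Siegel half-plane\<close>

lemma siegel_iff: "u \<in> siegel \<longleftrightarrow> (cmod (u $ 2))\<^sup>2 < Im (u $ 1)"
  by (simp add: siegel_def)

lemma open_siegel: "open siegel"
  unfolding siegel_def by (intro open_Collect_less continuous_intros)

lemma continuous_vector_2 [continuous_intros]:
  "continuous_on S f \<Longrightarrow> continuous_on S g \<Longrightarrow>
    continuous_on S (\<lambda>x. vector [f x, g x] :: complex^2)"
  unfolding vector_2_axis
  by (intro continuous_on_add bounded_linear.continuous_on[OF bounded_linear_axis])

text \<open>The maps \<open>(u1 + \<beta> u2 + \<kappa>, \<delta> u2 + \<epsilon>)\<close> are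
  closed under composition, and comparing coefficients turns the semigroup law into the four
  functional equations. The inequality \<open>self\<close> says that the height
  \<open>Im u1 - |u2|^2\<close> does not decrease.\<close>

lemma embeddable_affineI:
  fixes f \<beta> \<kappa> \<delta> \<epsilon> :: "real \<Rightarrow> complex"
  assumes cont: "continuous_on UNIV \<beta>" "continuous_on UNIV \<kappa>"
      "continuous_on UNIV \<delta>" "continuous_on UNIV \<epsilon>"
    and self: "\<And>t u. 0 \<le> t \<Longrightarrow> (cmod (\<delta> t * u + \<epsilon> t))\<^sup>2 \<le> (cmod u)\<^sup>2 + Im (\<beta> t * u + \<kappa> t)"
    and zero: "\<beta> 0 = 0" "\<kappa> 0 = 0" "\<delta> 0 = 1" "\<epsilon> 0 = 0"
    and \<beta>: "\<And>s t. \<beta> (t + s) = \<beta> s + \<beta> t * \<delta> s"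
    and \<kappa>: "\<And>s t. \<kappa> (t + s) = \<kappa> s + \<beta> t * \<epsilon> s + \<kappa> t"
    and \<delta>: "\<And>s t. \<delta> (t + s) = \<delta> t * \<delta> s"
    and \<epsilon>: "\<And>s t. \<epsilon> (t + s) = \<delta> t * \<epsilon> s + \<epsilon> t"
    and one: "\<And>u. u \<in> siegel \<Longrightarrow> \<psi> u = vector [u $ 1 + \<beta> 1 * u $ 2 + \<kappa> 1, \<delta> 1 * u $ 2 + \<epsilon> 1]"
  shows "embeddable \<psi> siegel"
proof -
  define \<Phi> :: "real \<Rightarrow> complex^2 \<Rightarrow> complex^2" where
    "\<Phi> = (\<lambda>t u. vector [u $ 1 + \<beta> t * u $ 2 + \<kappa> t, \<delta> t * u $ 2 + \<epsilon> t])"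
  have "continuous_semigroup \<Phi> siegel"
    unfolding continuous_semigroup_def
  proof (intro conjI allI impI ballI)
    fix t :: real assume "0 \<le> t"
    show "holomorphic_self_map (\<Phi> t) siegel"
      unfolding holomorphic_self_map_def \<Phi>_def
    proof (intro conjI holomorphic_map_vector_2 holomorphic_fun_at_intros image_subsetI)
      fix u assume "u \<in> siegel"
      then show "vector [u $ 1 + \<beta> t * u $ 2 + \<kappa> t, \<delta> t * u $ 2 + \<epsilon> t] \<in> siegel"
        using self[OF \<open>0 \<le> t\<close>, of "u $ 2"] by (simp add: siegel_iff)
    qed
  next
    show "continuous_map (top_of_set {0..}) (compact_open_topology siegel) \<Phi>"
      unfolding \<Phi>_def
      by (intro continuous_map_compact_open)
        (auto simp: case_prod_unfold intro!: continuous_intros cont[THEN continuous_on_compose2])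
  next
    fix s t :: real and z :: "complex^2"
    show "\<Phi> (t + s) z = \<Phi> t (\<Phi> s z)"
      unfolding \<Phi>_def \<beta> \<kappa> \<delta> \<epsilon> by (simp add: algebra_simps)
  qed (simp add: \<Phi>_def zero vector_2_eta)
  then show ?thesis
    unfolding embeddable_def using one by (auto simp: \<Phi>_def)
qed

section \<open>Constraints on affine self-maps of the half-plane\<close>

lemma linear_part_nonneg:
  fixes p q :: real
  assumes "\<And>x. 0 < x \<Longrightarrow> 0 \<le> p * x + q"
  shows "0 \<le> p"
proof (rule ccontr)
  assume "\<not> 0 \<le> p"
  then have "p * ((\<bar>q\<bar> + 1) / - p) = - (\<bar>q\<bar> + 1)" "0 < (\<bar>q\<bar> + 1) / - p"
    by (auto simp: divide_pos_neg)
  then show False using assms[of "(\<bar>q\<bar> + 1) / - p"] by linarith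
qed

lemma linear_part_eq_0:
  fixes p q :: real
  assumes "\<And>x. 0 \<le> p * x + q"
  shows "p = 0"
  using linear_part_nonneg[of p q] linear_part_nonneg[of "- p" q] assms[of "- _"] assms
  by fastforce

lemma quadratic_part_nonneg:
  fixes a p q :: real
  assumes "\<And>x. 0 \<le> a * x\<^sup>2 + p * x + q"
  shows "0 \<le> a"
proof (rule linear_part_nonneg)
  fix y :: real assume "0 < y"
  then show "0 \<le> a * y + q"
    \<comment> \<open>The average of the values at the two square roots of \<open>y\<close> has no
      linear term.\<close>
    using assms[of "sqrt y"] assms[of "- sqrt y"] by simp
qed

text \<open>A nonzero real-linear functional is unbounded below; the real axis detects
  \<open>Im \<beta>\<close> and the imaginary axis detects \<open>Re \<beta>\<close>. This is what
  kills or determines the shear coefficient in the normal forms.\<close>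

lemma Im_affine_bounded_below:
  assumes "\<And>u. 0 \<le> Im (\<beta> * u) + q"
  shows "\<beta> = 0"
proof -
  have "Im \<beta> = 0"
    using linear_part_eq_0[of "Im \<beta>" q] assms[of "complex_of_real _"] by simp
  moreover have "Re \<beta> = 0"
    using linear_part_eq_0[of "Re \<beta>" q] assms[of "\<i> * complex_of_real _"] by simp
  ultimately show ?thesis by (simp add: complex_eq_iff)
qed

text \<open>Over \<open>v\<close>, the point of height \<open>s\<close> is sent to a point of height
  \<open>\<alpha> s + k\<close>, where \<open>k\<close> is the difference of the two sides.
  Positivity for every \<open>s > 0\<close> gives \<open>k \<ge> 0\<close>, the statement on the
  boundary.\<close>

lemma siegel_affine_self_map_ineq:
  fixes \<alpha> :: real
  assumes self: "\<And>u. u \<in> siegel \<Longrightarrow>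
      vector [of_real \<alpha> * u $ 1 + \<beta> * u $ 2 + \<gamma>, \<delta> * u $ 2 + \<epsilon>] \<in> siegel"
  shows "(cmod (\<delta> * v + \<epsilon>))\<^sup>2 \<le> \<alpha> * (cmod v)\<^sup>2 + Im (\<beta> * v + \<gamma>)"
proof (rule ccontr)
  assume neg: "\<not> ?thesis"
  let ?k = "\<alpha> * (cmod v)\<^sup>2 + Im (\<beta> * v + \<gamma>) - (cmod (\<delta> * v + \<epsilon>))\<^sup>2"
  have *: "0 < \<alpha> * s + ?k" if "0 < s" for s
    using self[of "vector [Complex 0 ((cmod v)\<^sup>2 + s), v]"] that
    by (simp add: siegel_iff algebra_simps)
  have k: "?k < 0" using neg by simp
  show False
  proof (cases "0 < \<alpha>")
    case True
    \<comment> \<open>At this height the image would lie exactly on the boundary.\<close>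
    then show False using *[of "- ?k / \<alpha>"] k by (simp add: divide_neg_pos)
  next
    case False
    then show False using *[of 1] k by simp
  qed
qed

lemma cmod_affine_sq:
  "(cmod (\<delta> * of_real x + \<epsilon>))\<^sup>2 = (cmod \<delta>)\<^sup>2 * x\<^sup>2 + 2 * Re (\<delta> * cnj \<epsilon>) * x + (cmod \<epsilon>)\<^sup>2"
  unfolding cmod_power2 by (simp add: algebra_simps power2_eq_square)

text \<open>Along real \<open>v\<close> both sides are quadratic, so the leading coefficients
  compare.\<close>

lemma siegel_affine_slope_le_1:
  assumes "\<And>v. (cmod (\<delta> * v + \<epsilon>))\<^sup>2 \<le> (cmod v)\<^sup>2 + Im (\<beta> * v + \<gamma>)"
  shows "cmod \<delta> \<le> 1"
proof -
  have "0 \<le> (1 - (cmod \<delta>)\<^sup>2) * x\<^sup>2 + (Im \<beta> - 2 * Re (\<delta> * cnj \<epsilon>)) * x + (Im \<gamma> - (cmod \<epsilon>)\<^sup>2)" for x :: real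
    using assms[of "of_real x"] unfolding cmod_affine_sq by (simp add: algebra_simps)
  from quadratic_part_nonneg[OF this] show ?thesis
    by (simp add: power_le_one_iff)
qed

text \<open>Mean value inequality for \<open>exp (s \<alpha>)\<close> with
  \<open>\<alpha> = -\<mu> + \<i> v\<close>: its derivative has modulus
  \<open>|\<alpha>| exp (-\<mu> s)\<close>, whose integral over \<open>[0, t]\<close> is
  \<open>|\<alpha>| (1 - exp (-\<mu> t)) / \<mu>\<close>. The factor \<open>\<mu>\<close> is kept on
  the left to avoid the division.\<close>

lemma norm_one_minus_exp_le:
  assumes "0 < \<mu>" "0 \<le> t"
  shows "cmod (1 - exp (of_real t * (- of_real \<mu> + \<i> * of_real v))) * \<mu>
    \<le> sqrt (\<mu>\<^sup>2 + v\<^sup>2) * (1 - exp (- (\<mu> * t)))"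
proof -
  define \<alpha> where "\<alpha> = - of_real \<mu> + \<i> * complex_of_real v"
  have \<alpha>: "cmod \<alpha> = sqrt (\<mu>\<^sup>2 + v\<^sup>2)"
    by (simp add: \<alpha>_def cmod_def)
  let ?f = "\<lambda>s. exp (of_real s * \<alpha>) * of_real \<mu>"
  let ?g = "\<lambda>s. - (cmod \<alpha> * exp (- (\<mu> * s)))"
  have "norm (?f t - ?f 0) \<le> ?g t - ?g 0"
  proof (cases "t = 0")
    case False
    with assms have "0 < t" by simp
    then show ?thesis
    proof (rule differentiable_bound_general)
      show "continuous_on {0..t} ?f" "continuous_on {0..t} ?g"
        by (intro continuous_intros)+
      show "(?f has_vector_derivative \<alpha> * exp (of_real s * \<alpha>) * of_real \<mu>) (at s)" for s
        using has_vector_derivative_mult_left[OF exp_scaleR_has_vector_derivative_right[of \<alpha> s]]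
        by (simp add: scaleR_conv_of_real mult.commute)
      show "(?g has_vector_derivative cmod \<alpha> * \<mu> * exp (- (\<mu> * s))) (at s)" for s
        unfolding has_real_derivative_iff_has_vector_derivative[symmetric]
        by (rule derivative_eq_intros refl | simp)+
      show "norm (\<alpha> * exp (of_real s * \<alpha>) * of_real \<mu>) \<le> cmod \<alpha> * \<mu> * exp (- (\<mu> * s))" for s
      proof -
        have "cmod (exp (of_real s * \<alpha>)) = exp (- (\<mu> * s))"
          by (simp add: \<alpha>_def algebra_simps)
        then show ?thesis using assms by (simp add: norm_mult)
      qed
    qed
  qed simp
  moreover have "norm (?f t - ?f 0) = cmod (1 - exp (of_real t * \<alpha>)) * \<mu>"
    using assms norm_mult[of "1 - exp (of_real t * \<alpha>)" "of_real \<mu>"]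
    by (simp add: norm_minus_commute left_diff_distrib)
  ultimately show ?thesis
    unfolding \<alpha> unfolding \<alpha>_def by (simp add: algebra_simps)
qed

text \<open>With \<open>A = 1 - |\<delta> t|^2\<close> and \<open>B = |b' t|\<close>, the
  time-\<open>t\<close> map preserves the half-plane once
  \<open>A x^2 - 2 B x + t Im c \<ge> 0\<close> for \<open>x = |u2|\<close>. The discriminant
  condition \<open>B^2 \<le> t Im c A\<close> follows from the bound on \<open>Im c\<close>.\<close>

lemma embeddable_psi1:
  assumes \<mu>: "0 < \<mu>" and l: "l = exp (- of_real \<mu> + \<i> * of_real v)"
    and c: "(cmod b)\<^sup>2 * (\<mu>\<^sup>2 + v\<^sup>2) / (\<mu> * (cmod (1 - l))\<^sup>2) \<le> Im c"
  shows "embeddable (psi1 b c l) siegel"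
proof -
  define \<alpha> where "\<alpha> = - of_real \<mu> + \<i> * complex_of_real v"
  define \<delta> where "\<delta> = (\<lambda>t. exp (complex_of_real t * \<alpha>))"
  \<comment> \<open>The coboundary solution of \<open>b' (t + s) = b' s + b' t * \<delta> s\<close>,
    normalised by \<open>\<delta> 1 = l\<close> so that \<open>b' 1 = b\<close>.\<close>
  define b' where "b' = (\<lambda>t. b * (1 - \<delta> t) / (1 - l))"
  have l1: "l \<noteq> 1"
  proof
    assume "l = 1"
    then have "exp (- \<mu>) = 1" using l norm_exp_eq_Re[of "- of_real \<mu> + \<i> * of_real v"] by simp
    with \<mu> show False by simp
  qed
  have \<delta>: "\<delta> (s + t) = \<delta> s * \<delta> t" for s t
    by (simp add: \<delta>_def exp_add distrib_right)
  have \<delta>norm: "cmod (\<delta> t) = exp (- (\<mu> * t))" for t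
    by (simp add: \<delta>_def \<alpha>_def algebra_simps)
  have b'_bound: "(cmod (b' t))\<^sup>2 \<le> t * Im c * (1 - (cmod (\<delta> t))\<^sup>2)" if t: "0 \<le> t" for t
  proof -
    let ?e = "exp (- (\<mu> * t))"
    have e: "0 < ?e" "?e \<le> 1" "1 - ?e \<le> \<mu> * t"
      using \<mu> t exp_ge_add_one_self[of "- (\<mu> * t)"] by auto
    have "(cmod (1 - \<delta> t) * \<mu>)\<^sup>2 \<le> (sqrt (\<mu>\<^sup>2 + v\<^sup>2) * (1 - ?e))\<^sup>2"
      using norm_one_minus_exp_le[OF \<mu> t, of v] \<mu>
      by (intro power_mono) (auto simp: \<delta>_def \<alpha>_def)
    also have "\<dots> = (\<mu>\<^sup>2 + v\<^sup>2) * ((1 - ?e) * (1 - ?e))"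
      by (simp add: power_mult_distrib power2_eq_square[of "1 - ?e"])
    \<comment> \<open>One factor \<open>1 - ?e\<close> is bounded by \<open>\<mu> t\<close>,
      producing the factor \<open>t\<close> of \<open>t Im c\<close>; the other is enlarged by
      \<open>1 + ?e \<ge> 1\<close> to become \<open>1 - |\<delta> t|^2\<close>.\<close>
    also have "\<dots> \<le> (\<mu>\<^sup>2 + v\<^sup>2) * ((\<mu> * t) * ((1 - ?e) * (1 + ?e)))"
    proof (rule mult_left_mono)
      have "(1 - ?e) * (1 - ?e) \<le> (\<mu> * t) * (1 - ?e)"
        using e by (intro mult_right_mono) auto
      also have "\<dots> \<le> (\<mu> * t) * ((1 - ?e) * (1 + ?e))"
        using e \<mu> t by (intro mult_left_mono) (auto simp: algebra_simps)
      finally show "(1 - ?e) * (1 - ?e) \<le> (\<mu> * t) * ((1 - ?e) * (1 + ?e))" .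
    qed simp
    also have "(1 - ?e) * (1 + ?e) = 1 - (cmod (\<delta> t))\<^sup>2"
      unfolding \<delta>norm by (simp add: power2_eq_square algebra_simps)
    finally have "\<mu> * (\<mu> * (cmod (1 - \<delta> t))\<^sup>2) \<le> \<mu> * ((\<mu>\<^sup>2 + v\<^sup>2) * (t * (1 - (cmod (\<delta> t))\<^sup>2)))"
      by (simp add: power_mult_distrib power2_eq_square algebra_simps)
    then have *: "(cmod (1 - \<delta> t))\<^sup>2 \<le> (\<mu>\<^sup>2 + v\<^sup>2) * (t * (1 - (cmod (\<delta> t))\<^sup>2)) / \<mu>"
      using \<mu> by (simp only: mult_le_cancel_left_pos pos_le_divide_eq mult.commute[of _ \<mu>])
    have "(cmod (b' t))\<^sup>2 = (cmod b)\<^sup>2 / (cmod (1 - l))\<^sup>2 * (cmod (1 - \<delta> t))\<^sup>2"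
      by (simp add: b'_def norm_mult norm_divide power_mult_distrib power_divide)
    also have "\<dots> \<le> (cmod b)\<^sup>2 / (cmod (1 - l))\<^sup>2 * ((\<mu>\<^sup>2 + v\<^sup>2) * (t * (1 - (cmod (\<delta> t))\<^sup>2)) / \<mu>)"
      by (rule mult_left_mono[OF *]) simp
    also have "\<dots> = (cmod b)\<^sup>2 * (\<mu>\<^sup>2 + v\<^sup>2) / (\<mu> * (cmod (1 - l))\<^sup>2) * (t * (1 - (cmod (\<delta> t))\<^sup>2))"
      by (simp add: mult_ac)
    also have "\<dots> \<le> Im c * (t * (1 - (cmod (\<delta> t))\<^sup>2))"
      using c t \<mu> by (intro mult_right_mono) (auto simp: \<delta>norm power_le_one)
    finally show ?thesis by (simp add: mult_ac)
  qed
  show ?thesis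
  proof (rule embeddable_affineI[where \<beta> = "\<lambda>t. 2 * \<i> * b' t" and \<kappa> = "\<lambda>t. of_real t * c"
        and \<delta> = \<delta> and \<epsilon> = "\<lambda>_. 0"])
    fix t :: real and u :: complex assume t: "0 \<le> t"
    let ?x = "cmod u" and ?A = "1 - (cmod (\<delta> t))\<^sup>2" and ?B = "cmod (b' t)"
    have A: "0 \<le> ?A" using \<mu> t by (simp add: \<delta>norm power_le_one)
    have c0: "0 \<le> Im c" using c \<mu> by (intro order_trans[OF _ c]) (auto intro!: divide_nonneg_nonneg)
    \<comment> \<open>Arithmetic-geometric mean inequality for \<open>A x^2\<close> and
      \<open>t Im c\<close>, whose product dominates \<open>(B x)^2\<close>.\<close>
    have "2 * (?B * ?x) \<le> ?A * ?x\<^sup>2 + t * Im c"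
    proof (rule power2_le_imp_le)
      have "(2 * (?B * ?x))\<^sup>2 = 4 * (?B\<^sup>2 * ?x\<^sup>2)" by (simp add: power_mult_distrib)
      also have "\<dots> \<le> 4 * ((t * Im c * ?A) * ?x\<^sup>2)"
        using b'_bound[OF t] by (intro mult_left_mono mult_right_mono) auto
      also have "\<dots> \<le> (?A * ?x\<^sup>2 + t * Im c)\<^sup>2"
        using zero_le_power2[of "?A * ?x\<^sup>2 - t * Im c"] by (simp add: power2_eq_square algebra_simps)
      finally show "(2 * (?B * ?x))\<^sup>2 \<le> (?A * ?x\<^sup>2 + t * Im c)\<^sup>2" .
    qed (use A t c0 in auto)
    moreover have "- (2 * (?B * ?x)) \<le> Im (2 * \<i> * b' t * u)"
      using abs_Im_le_cmod[of "2 * \<i> * b' t * u"] by (simp add: norm_mult)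
    ultimately show "(cmod (\<delta> t * u + 0))\<^sup>2 \<le> ?x\<^sup>2 + Im (2 * \<i> * b' t * u + of_real t * c)"
      by (simp add: norm_mult power_mult_distrib algebra_simps)
  next
    fix s t :: real
    show "2 * \<i> * b' (t + s) = 2 * \<i> * b' s + 2 * \<i> * b' t * \<delta> s"
    proof -
      have "b * (1 - \<delta> t * \<delta> s) = b * (1 - \<delta> s) + b * (1 - \<delta> t) * \<delta> s"
        by (simp add: algebra_simps)
      then show ?thesis
        by (simp add: b'_def \<delta> add_divide_distrib distrib_left)
    qed
  next
    fix u show "psi1 b c l u = vector [u $ 1 + 2 * \<i> * b' 1 * u $ 2 + of_real 1 * c, \<delta> 1 * u $ 2 + 0]"
      using l1 by (simp add: psi1_def b'_def \<delta>_def \<alpha>_def l)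
  qed (use l1 in \<open>auto simp: b'_def \<delta>_def algebra_simps exp_add intro!: continuous_intros\<close>)
qed

text \<open>The boundary inequality at the origin gives \<open>Im c \<ge> 0\<close>, so translating
  by \<open>t c\<close> while rotating by \<open>t \<theta>\<close> never lowers the height.\<close>

lemma embeddable_psi2:
  assumes "holomorphic_self_map (psi2 c \<theta>) siegel"
  shows "embeddable (psi2 c \<theta>) siegel"
proof -
  have "(cmod (exp (\<i> * of_real \<theta>) * 0 + 0))\<^sup>2 \<le> 1 * (cmod 0)\<^sup>2 + Im (0 * 0 + c)"
    by (rule siegel_affine_self_map_ineq)
      (use assms in \<open>auto simp: holomorphic_self_map_def psi2_def\<close>)
  then have c: "0 \<le> Im c" by simp
  show ?thesis
    by (rule embeddable_affineI[where \<beta> = "\<lambda>_. 0" and \<kappa> = "\<lambda>t. of_real t * c"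
          and \<delta> = "\<lambda>t. exp (\<i> * of_real (t * \<theta>))" and \<epsilon> = "\<lambda>_. 0"])
      (use c in \<open>auto simp: psi2_def norm_mult exp_add[symmetric] algebra_simps
        intro!: continuous_intros\<close>)
qed

lemma embeddable_psi3:
  assumes "holomorphic_self_map (psi3 a c) siegel"
  shows "embeddable (psi3 a c) siegel"
proof -
  have "(cmod (1 * 0 + a))\<^sup>2 \<le> 1 * (cmod 0)\<^sup>2 + Im (2 * \<i> * cnj a * 0 + c)"
    by (rule siegel_affine_self_map_ineq)
      (use assms in \<open>auto simp: holomorphic_self_map_def psi3_def\<close>)
  then have c: "(cmod a)\<^sup>2 \<le> Im c" by simp
  \<comment> \<open>Splits \<open>psi3\<close> into the Heisenberg translation by \<open>a\<close>,
    whose constant is \<open>\<i> |a|^2\<close>, and a commuting translation of the first coordinate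
    by \<open>k\<close>. Scaling \<open>a\<close> to \<open>t a\<close> makes the first constant
    quadratic in \<open>t\<close>, the second linear.\<close>
  define k where "k = c - \<i> * of_real ((cmod a)\<^sup>2)"
  have k: "0 \<le> Im k" using c by (simp add: k_def)
  show ?thesis
  proof (rule embeddable_affineI[where \<beta> = "\<lambda>t. 2 * \<i> * cnj a * of_real t"
        and \<kappa> = "\<lambda>t. \<i> * of_real ((cmod a)\<^sup>2 * t\<^sup>2) + of_real t * k"
        and \<delta> = "\<lambda>t. 1" and \<epsilon> = "\<lambda>t. of_real t * a"])
    fix t :: real and u :: complex assume "0 \<le> t"
    then have "0 \<le> t * Im k" using k by simp
    then show "(cmod (1 * u + of_real t * a))\<^sup>2
        \<le> (cmod u)\<^sup>2 + Im (2 * \<i> * cnj a * of_real t * u + (\<i> * of_real ((cmod a)\<^sup>2 * t\<^sup>2) + of_real t * k))"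
      unfolding cmod_power2 by (simp add: power2_eq_square algebra_simps)
  next
    fix s t :: real
    show "\<i> * of_real ((cmod a)\<^sup>2 * (t + s)\<^sup>2) + of_real (t + s) * k =
        \<i> * of_real ((cmod a)\<^sup>2 * s\<^sup>2) + of_real s * k + 2 * \<i> * cnj a * of_real t * (of_real s * a)
        + (\<i> * of_real ((cmod a)\<^sup>2 * t\<^sup>2) + of_real t * k)"
      unfolding cmod_power2 by (simp add: complex_eq_iff power2_eq_square algebra_simps)
  qed (auto simp: psi3_def k_def algebra_simps intro!: continuous_intros)
qed

section \<open>The Cayley transform at a boundary point\<close>

text \<open>The Hermitian product of \<open>z\<close> with \<open>w\<close>.\<close>

definition coord :: "complex^2 \<Rightarrow> complex^2 \<Rightarrow> complex" where
  "coord w z = z $ 1 * cnj (w $ 1) + z $ 2 * cnj (w $ 2)"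

text \<open>The Hermitian product of \<open>z\<close> with the vector
  \<open>(- cnj w2, cnj w1)\<close> orthogonal to \<open>w\<close>.\<close>

definition perp_coord :: "complex^2 \<Rightarrow> complex^2 \<Rightarrow> complex" where
  "perp_coord w z = z $ 2 * w $ 1 - z $ 1 * w $ 2"

text \<open>The Cayley transform that sends the boundary point \<open>w\<close> to infinity, written in the orthonormal
  frame \<open>w\<close>, \<open>(- cnj w\<^sub>2, cnj w\<^sub>1)\<close>.\<close>

definition cayley :: "complex^2 \<Rightarrow> complex^2 \<Rightarrow> complex^2" where
  "cayley w z = vector [\<i> * (1 + coord w z) / (1 - coord w z), \<i> * perp_coord w z / (1 - coord w z)]"

text \<open>With \<open>s = (u1 - \<i>) / (u1 + \<i>)\<close> and
  \<open>t = 2 u2 / (u1 + \<i>)\<close> the frame coordinates of the preimage, this is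
  \<open>s w + t (- cnj w2, cnj w1)\<close>.\<close>

definition cayley_inv :: "complex^2 \<Rightarrow> complex^2 \<Rightarrow> complex^2" where
  "cayley_inv w u =
    vector [((u $ 1 - \<i>) * w $ 1 - 2 * u $ 2 * cnj (w $ 2)) / (u $ 1 + \<i>),
      ((u $ 1 - \<i>) * w $ 2 + 2 * u $ 2 * cnj (w $ 1)) / (u $ 1 + \<i>)]"

text \<open>Defining function of the half-plane; its level sets are the horospheres centred at
  infinity.\<close>

definition siegel_height :: "complex^2 \<Rightarrow> real" where
  "siegel_height u = Im (u $ 1) - (cmod (u $ 2))\<^sup>2"

lemma siegel_height_pos: "u \<in> siegel \<longleftrightarrow> 0 < siegel_height u"
  by (simp add: siegel_iff siegel_height_def)

lemma norm_complex2_sq: "(norm (z :: complex^2))\<^sup>2 = (cmod (z $ 1))\<^sup>2 + (cmod (z $ 2))\<^sup>2"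
  by (simp add: norm_vec_def L2_set_def sum_2)

context
  fixes w :: "complex^2"
  assumes w: "norm w = 1"
begin

lemma w_sq: "(cmod (w $ 1))\<^sup>2 + (cmod (w $ 2))\<^sup>2 = 1"
  using norm_complex2_sq[of w] w by simp

lemma w_cnj: "w $ 1 * cnj (w $ 1) + w $ 2 * cnj (w $ 2) = 1"
  using w_sq by (simp add: complex_norm_square[symmetric] flip: of_real_add of_real_power)

lemma coord_w: "coord w w = 1" "perp_coord w w = 0"
  using w_cnj by (simp_all add: coord_def perp_coord_def)

lemma coord_frame:
  "coord w (vector [s * w $ 1 - t * cnj (w $ 2), s * w $ 2 + t * cnj (w $ 1)]) = s"
  "perp_coord w (vector [s * w $ 1 - t * cnj (w $ 2), s * w $ 2 + t * cnj (w $ 1)]) = t"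
proof -
  have "coord w (vector [s * w $ 1 - t * cnj (w $ 2), s * w $ 2 + t * cnj (w $ 1)]) =
      s * (w $ 1 * cnj (w $ 1) + w $ 2 * cnj (w $ 2))"
    by (simp add: coord_def algebra_simps)
  then show "coord w (vector [s * w $ 1 - t * cnj (w $ 2), s * w $ 2 + t * cnj (w $ 1)]) = s"
    by (simp add: w_cnj)
  have "perp_coord w (vector [s * w $ 1 - t * cnj (w $ 2), s * w $ 2 + t * cnj (w $ 1)]) =
      t * (w $ 1 * cnj (w $ 1) + w $ 2 * cnj (w $ 2))"
    by (simp add: perp_coord_def algebra_simps)
  then show "perp_coord w (vector [s * w $ 1 - t * cnj (w $ 2), s * w $ 2 + t * cnj (w $ 1)]) = t"
    by (simp add: w_cnj)
qed

lemma frame_expansion: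
  "z $ 1 = coord w z * w $ 1 - perp_coord w z * cnj (w $ 2)"
  "z $ 2 = coord w z * w $ 2 + perp_coord w z * cnj (w $ 1)"
proof -
  have "coord w z * w $ 1 - perp_coord w z * cnj (w $ 2) =
      z $ 1 * (w $ 1 * cnj (w $ 1) + w $ 2 * cnj (w $ 2))"
    by (simp add: coord_def perp_coord_def algebra_simps)
  then show "z $ 1 = coord w z * w $ 1 - perp_coord w z * cnj (w $ 2)"
    by (simp add: w_cnj)
  have "coord w z * w $ 2 + perp_coord w z * cnj (w $ 1) =
      z $ 2 * (w $ 1 * cnj (w $ 1) + w $ 2 * cnj (w $ 2))"
    by (simp add: coord_def perp_coord_def algebra_simps)
  then show "z $ 2 = coord w z * w $ 2 + perp_coord w z * cnj (w $ 1)"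
    by (simp add: w_cnj)
qed

lemma norm_coord: "(norm z)\<^sup>2 = (cmod (coord w z))\<^sup>2 + (cmod (perp_coord w z))\<^sup>2"
proof -
  have "(cmod (coord w z))\<^sup>2 + (cmod (perp_coord w z))\<^sup>2 =
      ((cmod (z $ 1))\<^sup>2 + (cmod (z $ 2))\<^sup>2) * ((cmod (w $ 1))\<^sup>2 + (cmod (w $ 2))\<^sup>2)"
    unfolding cmod_power2 by (simp add: coord_def perp_coord_def power2_eq_square algebra_simps)
  then show ?thesis by (simp add: norm_complex2_sq w_sq)
qed

lemma coord_neq_1:
  assumes "norm z < 1"
  shows "coord w z \<noteq> 1"
proof
  assume "coord w z = 1"
  then have "1 \<le> (norm z)\<^sup>2" using norm_coord[of z] by simp
  with assms show False by (simp add: abs_square_less_1 flip: not_less)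
qed

text \<open>The first coordinate has imaginary part \<open>(1 - |s|^2) / |1 - s|^2\<close>, the
  second squared modulus \<open>|t|^2 / |1 - s|^2\<close>, and \<open>|s|^2 + |t|^2\<close> is the
  squared norm of \<open>z\<close>. The identity places the image in the half-plane and later
  rewrites the dilation quotient.\<close>

lemma siegel_height_cayley:
  assumes "coord w z \<noteq> 1"
  shows "siegel_height (cayley w z) = (1 - (norm z)\<^sup>2) / (cmod (1 - coord w z))\<^sup>2"
proof -
  define s where "s = coord w z"
  have s: "1 - s \<noteq> 0" using assms by (simp add: s_def)
  have "\<i> * (1 + s) / (1 - s) = \<i> * (1 + s) * cnj (1 - s) / of_real ((cmod (1 - s))\<^sup>2)"
    by (subst complex_div_cnj) simp
  then have "Im (\<i> * (1 + s) / (1 - s)) = Re ((1 + s) * cnj (1 - s)) / (cmod (1 - s))\<^sup>2"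
    by (simp only: Im_divide_of_real) (simp add: algebra_simps)
  also have "Re ((1 + s) * cnj (1 - s)) = 1 - (cmod s)\<^sup>2"
    unfolding cmod_power2 by (simp add: power2_eq_square algebra_simps)
  finally have "Im (\<i> * (1 + s) / (1 - s)) = (1 - (cmod s)\<^sup>2) / (cmod (1 - s))\<^sup>2" .
  then show ?thesis
    by (simp add: siegel_height_def cayley_def norm_coord s_def[symmetric] norm_divide norm_mult
        power_divide diff_divide_distrib add_divide_distrib)
qed

lemma cayley_in_siegel:
  assumes "norm z < 1"
  shows "cayley w z \<in> siegel"
  using assms coord_neq_1[OF assms]
  by (simp add: siegel_height_pos siegel_height_cayley abs_square_less_1)

lemma siegel_denominator: "u \<in> siegel \<Longrightarrow> u $ 1 + \<i> \<noteq> 0"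
  by (auto simp: siegel_iff complex_eq_iff) (smt (verit) zero_le_power2)

lemma coord_cayley_inv:
  "coord w (cayley_inv w u) = (u $ 1 - \<i>) / (u $ 1 + \<i>)"
  "perp_coord w (cayley_inv w u) = 2 * u $ 2 / (u $ 1 + \<i>)"
proof -
  have "cayley_inv w u =
      vector [(u $ 1 - \<i>) / (u $ 1 + \<i>) * w $ 1 - 2 * u $ 2 / (u $ 1 + \<i>) * cnj (w $ 2),
        (u $ 1 - \<i>) / (u $ 1 + \<i>) * w $ 2 + 2 * u $ 2 / (u $ 1 + \<i>) * cnj (w $ 1)]"
    by (simp add: cayley_inv_def flip: diff_divide_distrib add_divide_distrib)
  then show "coord w (cayley_inv w u) = (u $ 1 - \<i>) / (u $ 1 + \<i>)"
    "perp_coord w (cayley_inv w u) = 2 * u $ 2 / (u $ 1 + \<i>)"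
    by (simp_all only: coord_frame)
qed

lemma one_minus_coord_cayley_inv:
  "u \<in> siegel \<Longrightarrow> 1 - coord w (cayley_inv w u) = 2 * \<i> / (u $ 1 + \<i>)"
  using siegel_denominator[of u] by (simp add: coord_cayley_inv field_simps)

lemma cayley_cayley_inv:
  assumes "u \<in> siegel"
  shows "cayley w (cayley_inv w u) = u"
proof -
  have *: "1 + coord w (cayley_inv w u) = 2 * u $ 1 / (u $ 1 + \<i>)"
    using siegel_denominator[OF assms] by (simp add: coord_cayley_inv field_simps)
  then show ?thesis
    unfolding cayley_def one_minus_coord_cayley_inv[OF assms] * coord_cayley_inv(2)
    using siegel_denominator[OF assms] by (simp add: vec_eq_iff forall_2)
qed

lemma cayley_inv_cayley:
  assumes "norm z < 1"
  shows "cayley_inv w (cayley w z) = z"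
proof -
  let ?s = "coord w z" and ?t = "perp_coord w z"
  have s: "1 - ?s \<noteq> 0" using coord_neq_1[OF assms] by simp
  have 1: "cayley w z $ 1 + \<i> = 2 * \<i> / (1 - ?s)" "cayley w z $ 1 - \<i> = 2 * \<i> * ?s / (1 - ?s)"
    and 2: "2 * cayley w z $ 2 = 2 * \<i> * ?t / (1 - ?s)"
    using s by (simp_all add: cayley_def field_simps)
  have *: "(2 * \<i> * ?s / (1 - ?s) * x + 2 * \<i> * ?t / (1 - ?s) * y) / (2 * \<i> / (1 - ?s)) =
      ?s * x + ?t * y" for x y
  proof -
    have "2 * \<i> * ?s / (1 - ?s) * x + 2 * \<i> * ?t / (1 - ?s) * y =
        (?s * x + ?t * y) * (2 * \<i> / (1 - ?s))"
      by (simp add: algebra_simps add_divide_distrib)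
    then show ?thesis
      using s by (metis divide_eq_0_iff mult_eq_0_iff nonzero_mult_div_cancel_right
          zero_neq_numeral complex_i_not_zero)
  qed
  show ?thesis
    unfolding cayley_inv_def 1 2
    using *[of "w $ 1" "- cnj (w $ 2)"] *[of "w $ 2" "cnj (w $ 1)"]
    by (simp only: mult_minus_right add_uminus_conv_diff vec_eq_iff forall_2 vector_2
        frame_expansion[symmetric] simp_thms)
qed

lemma cayley_inv_in_ball:
  assumes "u \<in> siegel"
  shows "norm (cayley_inv w u) < 1"
proof -
  have ne: "coord w (cayley_inv w u) \<noteq> 1"
    using one_minus_coord_cayley_inv[OF assms] siegel_denominator[OF assms] by auto
  \<comment> \<open>The height identity read backwards: positive height forces
    \<open>1 - |z|^2 > 0\<close>.\<close>
  have "0 < (1 - (norm (cayley_inv w u))\<^sup>2) / (cmod (1 - coord w (cayley_inv w u)))\<^sup>2"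
    using siegel_height_cayley[OF ne] assms
    by (simp add: cayley_cayley_inv[OF assms] siegel_height_pos)
  then have "0 < 1 - (norm (cayley_inv w u))\<^sup>2"
    using ne by (simp add: zero_less_divide_iff)
  then show ?thesis by (simp add: abs_square_less_1)
qed

lemma holomorphic_cayley: "holomorphic_map (cayley w) unit_ball"
  unfolding cayley_def coord_def perp_coord_def
  by (intro holomorphic_map_vector_2 holomorphic_fun_at_intros)
    (use coord_neq_1 in \<open>auto simp: coord_def\<close>)

lemma holomorphic_cayley_inv: "holomorphic_map (cayley_inv w) siegel"
  unfolding cayley_inv_def
  by (intro holomorphic_map_vector_2 holomorphic_fun_at_intros siegel_denominator)

end

section \<open>Linear fractional maps in Siegel coordinates\<close>

text \<open>Numerators and denominator are affine in \<open>z\<close>, hence in the frame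
  coordinates. The equations stay multiplied out so that limits at \<open>w\<close> can be taken
  even if the denominator vanishes there.\<close>

lemma LFM_coords:
  assumes w: "norm w = 1" and \<phi>: "\<phi> \<in> (LFM :: (complex^2 \<Rightarrow> complex^2) set)"
  obtains q0 q1 q2 a0 a1 a2 b0 b1 b2 where
    "\<And>z. norm z < 1 \<Longrightarrow> q0 + q1 * coord w z + q2 * perp_coord w z \<noteq> 0"
    "\<And>z. norm z < 1 \<Longrightarrow> coord w (\<phi> z) * (q0 + q1 * coord w z + q2 * perp_coord w z) =
      a0 + a1 * coord w z + a2 * perp_coord w z"
    "\<And>z. norm z < 1 \<Longrightarrow> perp_coord w (\<phi> z) * (q0 + q1 * coord w z + q2 * perp_coord w z) =
      b0 + b1 * coord w z + b2 * perp_coord w z"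
proof -
  from \<phi> obtain A :: "complex^2^2" and B C D where
    "\<forall>z\<in>unit_ball. hermitian_inner z C + D \<noteq> 0 \<and>
      \<phi> z = inverse (hermitian_inner z C + D) *s (A *v z + B)"
    unfolding LFM_def by blast
  then have *: "hermitian_inner z C + D \<noteq> 0"
    "\<phi> z = inverse (hermitian_inner z C + D) *s (A *v z + B)" if "norm z < 1" for z
    using that by (simp_all add: Ball_def)
  define p :: "complex^2" where "p = vector [- cnj (w $ 2), cnj (w $ 1)]"
  have z: "z = coord w z *s w + perp_coord w z *s p" for z
    using frame_expansion[OF w, of z] by (simp add: vec_eq_iff forall_2 p_def)
  have q: "hermitian_inner z C + D =
      D + hermitian_inner w C * coord w z + hermitian_inner p C * perp_coord w z" for z
    by (subst z) (simp add: hermitian_inner_def sum_2 algebra_simps)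
  have Az: "A *v z + B = coord w z *s (A *v w) + perp_coord w z *s (A *v p) + B" for z
    by (subst z) (simp add: matrix_vector_right_distrib vector_scalar_commute)
  have lin: "coord w (k *s v) = k * coord w v" "coord w (v + v') = coord w v + coord w v'"
    "perp_coord w (k *s v) = k * perp_coord w v"
    "perp_coord w (v + v') = perp_coord w v + perp_coord w v'" for k v v'
    by (simp_all add: coord_def perp_coord_def algebra_simps)
  show ?thesis
  proof (rule that)
    fix z :: "complex^2" assume z: "norm z < 1"
    show "D + hermitian_inner w C * coord w z + hermitian_inner p C * perp_coord w z \<noteq> 0"
      using *(1)[OF z] unfolding q .
    show "coord w (\<phi> z) * (D + hermitian_inner w C * coord w z + hermitian_inner p C * perp_coord w z) =
        coord w B + coord w (A *v w) * coord w z + coord w (A *v p) * perp_coord w z"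
      using *(1)[OF z] unfolding q[symmetric] *(2)[OF z] Az lin by (simp add: field_simps)
    show "perp_coord w (\<phi> z) * (D + hermitian_inner w C * coord w z + hermitian_inner p C * perp_coord w z) =
        perp_coord w B + perp_coord w (A *v w) * coord w z + perp_coord w (A *v p) * perp_coord w z"
      using *(1)[OF z] unfolding q[symmetric] *(2)[OF z] Az lin by (simp add: field_simps)
  qed
qed

lemma tendsto_coord:
  assumes "(f \<longlongrightarrow> x) F"
  shows "((\<lambda>n. coord w (f n)) \<longlongrightarrow> coord w x) F"
    and "((\<lambda>n. perp_coord w (f n)) \<longlongrightarrow> perp_coord w x) F"
  unfolding coord_def perp_coord_def by (intro tendsto_intros assms)+

lemma denjoy_wolff_point_tendsto:
  assumes "denjoy_wolff_point \<phi> w" "norm z < 1"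
  shows "(\<lambda>n. (\<phi> ^^ n) z) \<longlonglongrightarrow> w"
proof -
  have "compact {z} \<and> {z} \<subseteq> unit_ball" using assms(2) by simp
  with assms(1) have "uniform_limit {z} (\<lambda>n. \<phi> ^^ n) (\<lambda>_. w) sequentially"
    unfolding denjoy_wolff_point_def by blast
  then show ?thesis by (rule tendsto_uniform_limitI) simp
qed

text \<open>Passing to the limit in \<open>q(z\<^sub>n) z\<^bsub>n+1\<^esub> = A z\<^sub>n + B\<close> along an orbit shows that \<open>w\<close> is fixed
  projectively, even if the denominator \<open>q\<close> were to vanish at \<open>w\<close>. So the conjugated map has its
  pole at infinity only, and hence is affine.\<close>

lemma LFM_cayley_affine:
  fixes \<phi> :: "complex^2 \<Rightarrow> complex^2"
  assumes \<phi>: "\<phi> \<in> LFM" and dw: "denjoy_wolff_point \<phi> w"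
  obtains \<alpha> \<beta> \<gamma> \<delta> \<epsilon> where
    "\<And>z. norm z < 1 \<Longrightarrow> cayley w (\<phi> z) =
      vector [\<alpha> * cayley w z $ 1 + \<beta> * cayley w z $ 2 + \<gamma>, \<delta> * cayley w z $ 2 + \<epsilon>]"
proof -
  have w: "norm w = 1" using dw by (simp add: denjoy_wolff_point_def)
  have "\<phi> ` unit_ball \<subseteq> unit_ball" using \<phi> unfolding LFM_def by blast
  then have \<phi>_ball: "norm (\<phi> z) < 1" if "norm z < 1" for z
    using that by (metis image_subset_iff mem_ball_0)
  obtain q0 q1 q2 a0 a1 a2 b0 b1 b2 where
    q: "\<And>z. norm z < 1 \<Longrightarrow> q0 + q1 * coord w z + q2 * perp_coord w z \<noteq> 0"
    and a: "\<And>z. norm z < 1 \<Longrightarrow> coord w (\<phi> z) * (q0 + q1 * coord w z + q2 * perp_coord w z) =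
      a0 + a1 * coord w z + a2 * perp_coord w z"
    and b: "\<And>z. norm z < 1 \<Longrightarrow> perp_coord w (\<phi> z) * (q0 + q1 * coord w z + q2 * perp_coord w z) =
      b0 + b1 * coord w z + b2 * perp_coord w z"
    using LFM_coords[OF w \<phi>] by metis
  define x where "x = (\<lambda>n. (\<phi> ^^ n) 0)"
  have x_ball: "norm (x n) < 1" for n
    by (induction n) (simp_all add: x_def \<phi>_ball)
  have x_lim: "x \<longlonglongrightarrow> w"
    unfolding x_def by (rule denjoy_wolff_point_tendsto[OF dw]) simp
  then have x_Suc: "(\<lambda>n. \<phi> (x n)) \<longlonglongrightarrow> w"
    using LIMSEQ_Suc[of x] by (simp add: x_def)
  note s = tendsto_coord(1)[OF x_lim, of w, unfolded coord_w[OF w]]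
    and t = tendsto_coord(2)[OF x_lim, of w, unfolded coord_w[OF w]]
    and s' = tendsto_coord(1)[OF x_Suc, of w, unfolded coord_w[OF w]]
    and t' = tendsto_coord(2)[OF x_Suc, of w, unfolded coord_w[OF w]]
  have "(\<lambda>n. coord w (\<phi> (x n)) * (q0 + q1 * coord w (x n) + q2 * perp_coord w (x n)))
      \<longlonglongrightarrow> 1 * (q0 + q1 * 1 + q2 * 0)"
    by (intro tendsto_intros s t s')
  moreover have "(\<lambda>n. a0 + a1 * coord w (x n) + a2 * perp_coord w (x n)) \<longlonglongrightarrow> a0 + a1 * 1 + a2 * 0"
    by (intro tendsto_intros s t)
  ultimately have qa: "q0 + q1 = a0 + a1"
    unfolding a[OF x_ball] by (auto dest: LIMSEQ_unique)
  have "(\<lambda>n. perp_coord w (\<phi> (x n)) * (q0 + q1 * coord w (x n) + q2 * perp_coord w (x n)))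
      \<longlonglongrightarrow> 0 * (q0 + q1 * 1 + q2 * 0)"
    by (intro tendsto_intros s t t')
  moreover have "(\<lambda>n. b0 + b1 * coord w (x n) + b2 * perp_coord w (x n)) \<longlonglongrightarrow> b0 + b1 * 1 + b2 * 0"
    by (intro tendsto_intros s t)
  ultimately have b1: "b1 = - b0"
    unfolding b[OF x_ball] by (auto dest: LIMSEQ_unique simp: eq_neg_iff_add_eq_0 add.commute)
  define \<eta> where "\<eta> = q0 - a0"
  have qa1: "q1 - a1 = - \<eta>" using qa by (simp add: \<eta>_def algebra_simps)
  \<comment> \<open>The limit relation \<open>q0 + q1 = a0 + a1\<close> makes the constant and the
    \<open>coord\<close> coefficient opposite, so they combine into a multiple of
    \<open>1 - coord w z\<close>.\<close>
  have denom: "(1 - coord w (\<phi> z)) * (q0 + q1 * coord w z + q2 * perp_coord w z) =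
      \<eta> * (1 - coord w z) + (q2 - a2) * perp_coord w z" if "norm z < 1" for z
  proof -
    have "(1 - coord w (\<phi> z)) * (q0 + q1 * coord w z + q2 * perp_coord w z) =
        \<eta> + (q1 - a1) * coord w z + (q2 - a2) * perp_coord w z"
      unfolding left_diff_distrib a[OF that] by (simp add: \<eta>_def algebra_simps)
    then show ?thesis unfolding qa1 by (simp add: algebra_simps)
  qed
  have denom_nz: "\<eta> * (1 - coord w z) + (q2 - a2) * perp_coord w z \<noteq> 0" if "norm z < 1" for z
    unfolding denom[OF that, symmetric] using q[OF that] coord_neq_1[OF w \<phi>_ball[OF that]] by simp
  have q2: "q2 = a2"
  proof (rule ccontr)
    assume "q2 \<noteq> a2"
    \<comment> \<open>In Siegel coordinates the nonvanishing expression is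
      \<open>2 (\<i> \<eta> + (q2 - a2) u2) / (u1 + \<i>)\<close>. It vanishes at
      \<open>u2 = v\<close>, and \<open>u1\<close> is free to lift this point into the
      half-plane.\<close>
    define v where "v = - \<i> * \<eta> / (q2 - a2)"
    define u :: "complex^2" where "u = vector [Complex 0 ((cmod v)\<^sup>2 + 1), v]"
    have u: "u \<in> siegel" by (simp add: u_def siegel_iff)
    have "2 * u $ 2 * (q2 - a2) = - 2 * \<i> * \<eta>"
      using \<open>q2 \<noteq> a2\<close> by (simp add: u_def v_def)
    then have "\<eta> * (1 - coord w (cayley_inv w u)) + (q2 - a2) * perp_coord w (cayley_inv w u) = 0"
      unfolding one_minus_coord_cayley_inv[OF w u]
      unfolding coord_cayley_inv[OF w] times_divide_eq_right
      by (simp only: mult.commute[of "q2 - a2"] mult.commute[of \<eta>] mult_minus_left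
          minus_divide_left[symmetric] add.right_inverse)
    with denom_nz[OF cayley_inv_in_ball[OF w u]] show False by blast
  qed
  have \<eta>: "\<eta> \<noteq> 0"
    using denom_nz[of 0] by (auto simp: q2)
  show ?thesis
  proof (rule that)
    fix z :: "complex^2" assume z: "norm z < 1"
    let ?s = "coord w z" and ?t = "perp_coord w z"
    let ?s' = "coord w (\<phi> z)" and ?t' = "perp_coord w (\<phi> z)"
    define Q where "Q = q0 + q1 * ?s + q2 * ?t"
    have Q: "Q \<noteq> 0" using q[OF z] by (simp add: Q_def)
    have s: "1 - ?s \<noteq> 0" using coord_neq_1[OF w z] by simp
    have D: "(1 - ?s') * Q = \<eta> * (1 - ?s)"
      using denom[OF z] by (simp add: Q_def q2)
    have N1: "(1 + ?s') * Q = (q0 + a0) + (q1 + a1) * ?s + (q2 + a2) * ?t"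
      unfolding distrib_right Q_def a[OF z] by (simp add: algebra_simps)
    have N2: "?t' * Q = b0 * (1 - ?s) + b2 * ?t"
      unfolding Q_def b[OF z] b1 by (simp add: algebra_simps)
    have "cayley w (\<phi> z) $ 1 = \<i> * ((1 + ?s') * Q) / ((1 - ?s') * Q)"
      using Q by (simp add: cayley_def)
    also have "\<dots> = (q0 + a0 + q1 + a1) / (2 * \<eta>) * cayley w z $ 1 + (q2 + a2) / \<eta> * cayley w z $ 2
        + \<i> * (q0 + a0 - q1 - a1) / (2 * \<eta>)"
    proof -
      \<comment> \<open>Naming the inverses leaves a polynomial identity in which only
        \<open>(1 - ?s) * k = 1\<close> is used.\<close>
      define k m where "k = inverse (1 - ?s)" and "m = inverse \<eta>"
      have k: "(1 - ?s) * k = 1" using s by (simp add: k_def)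
      have u: "cayley w z $ 1 = \<i> * (1 + ?s) * k" "cayley w z $ 2 = \<i> * ?t * k"
        by (simp_all add: cayley_def k_def divide_inverse)
      have "\<i> * ((q0 + a0) + (q1 + a1) * ?s + (q2 + a2) * ?t) * (m * k) =
          (q0 + a0 + q1 + a1) * m / 2 * (\<i> * (1 + ?s) * k) + (q2 + a2) * m * (\<i> * ?t * k)
          + \<i> * (q0 + a0 - q1 - a1) * m / 2 * ((1 - ?s) * k)"
        by (simp add: field_simps)
      moreover have "x / (\<eta> * (1 - ?s)) = x * (m * k)" "x / (2 * \<eta>) = x * m / 2" "x / \<eta> = x * m" for x
        by (simp_all add: k_def m_def inverse_eq_divide)
      ultimately show ?thesis
        unfolding N1 D u by (simp only: k mult_1_right)
    qed
    finally have 1: "cayley w (\<phi> z) $ 1 = \<dots>" .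
    have "cayley w (\<phi> z) $ 2 = \<i> * (?t' * Q) / ((1 - ?s') * Q)"
      using Q by (simp add: cayley_def)
    also have "\<dots> = b2 / \<eta> * cayley w z $ 2 + \<i> * b0 / \<eta>"
      unfolding N2 D using s \<eta> by (simp add: cayley_def field_simps)
    finally show "cayley w (\<phi> z) = vector
        [(q0 + a0 + q1 + a1) / (2 * \<eta>) * cayley w z $ 1 + (q2 + a2) / \<eta> * cayley w z $ 2
          + \<i> * (q0 + a0 - q1 - a1) / (2 * \<eta>), b2 / \<eta> * cayley w z $ 2 + \<i> * b0 / \<eta>]"
      using 1 by (simp add: vec_eq_iff forall_2)
  qed
qed

section \<open>The scaling factor and the dilation coefficient\<close>

text \<open>On the slice \<open>u2 = 0\<close> the real part of \<open>u1\<close> is arbitrary, so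
  \<open>Im \<alpha>\<close> must vanish; letting \<open>Im u1\<close> grow gives the sign of
  \<open>Re \<alpha>\<close>.\<close>

lemma siegel_affine_scale_real:
  assumes self: "\<And>u. u \<in> siegel \<Longrightarrow>
      vector [\<alpha> * u $ 1 + \<beta> * u $ 2 + \<gamma>, \<delta> * u $ 2 + \<epsilon>] \<in> siegel"
  shows "\<alpha> = of_real (Re \<alpha>)" "0 \<le> Re \<alpha>"
proof -
  have *: "0 \<le> Im \<alpha> * x + Re \<alpha> * y + Im \<gamma>" if "0 < y" for x y
  proof -
    have "(cmod \<epsilon>)\<^sup>2 < Im \<alpha> * x + Re \<alpha> * y + Im \<gamma>"
      using self[of "vector [Complex x y, 0]"] that by (simp add: siegel_iff algebra_simps)
    then show ?thesis using zero_le_power2[of "cmod \<epsilon>"] by linarith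
  qed
  have "Im \<alpha> = 0"
    using linear_part_eq_0[of "Im \<alpha>" "Re \<alpha> + Im \<gamma>"] *[of 1] by (simp add: add.assoc)
  then show "\<alpha> = of_real (Re \<alpha>)" by (simp add: complex_eq_iff)
  show "0 \<le> Re \<alpha>"
    using linear_part_nonneg[of "Re \<alpha>" "Im \<gamma>"] *[of _ 0] by simp
qed

text \<open>In Siegel coordinates the boundary dilation coefficient at \<open>w\<close> is the reciprocal of the
  scaling factor \<open>\<alpha>\<close>: the quotient is at least \<open>\<alpha> / \<bar>g\<bar>\<^sup>2\<close> with \<open>g\<close> an affine function with value \<open>\<alpha>\<close>
  at \<open>w\<close>, and it tends to \<open>1 / \<alpha>\<close> along the radius.\<close>

lemma dilation_scale_eq_1:
  fixes \<phi> :: "complex^2 \<Rightarrow> complex^2" and \<alpha> :: real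
  assumes w: "norm w = 1"
    and \<phi>: "\<And>z. norm z < 1 \<Longrightarrow> norm (\<phi> z) < 1"
    and F: "\<And>z. norm z < 1 \<Longrightarrow> cayley w (\<phi> z) =
      vector [of_real \<alpha> * cayley w z $ 1 + \<beta> * cayley w z $ 2 + \<gamma>, \<delta> * cayley w z $ 2 + \<epsilon>]"
    and ineq: "\<And>v. (cmod (\<delta> * v + \<epsilon>))\<^sup>2 \<le> \<alpha> * (cmod v)\<^sup>2 + Im (\<beta> * v + \<gamma>)"
    and \<alpha>: "0 < \<alpha>"
    and dil: "boundary_dilation \<phi> w = 1"
  shows "\<alpha> = 1"
proof -
  define R where "R = (\<lambda>z. (1 - (norm (\<phi> z))\<^sup>2) / (1 - (norm z)\<^sup>2))"
  \<comment> \<open>The quotient \<open>(1 - coord w z) / (1 - coord w (\<phi> z))\<close> in affine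
    form: \<open>1 - coord\<close> equals \<open>2 \<i> / (u1 + \<i>)\<close> in Siegel
    coordinates.\<close>
  define g where "g = (\<lambda>z. of_real \<alpha> + \<beta> * perp_coord w z / 2
      + (\<gamma> + \<i> - of_real \<alpha> * \<i>) * (1 - coord w z) / (2 * \<i>))"
  have R_eq: "R z = siegel_height (cayley w (\<phi> z)) / siegel_height (cayley w z) / (cmod (g z))\<^sup>2"
    if z: "norm z < 1" for z
  proof -
    let ?s = "coord w z" and ?s' = "coord w (\<phi> z)"
    have s: "1 - ?s \<noteq> 0" "1 - ?s' \<noteq> 0"
      using coord_neq_1[OF w z] coord_neq_1[OF w \<phi>[OF z]] by auto
    have "2 * \<i> / (1 - ?s') = cayley w (\<phi> z) $ 1 + \<i>"
      using s by (simp add: cayley_def field_simps)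
    also have "\<dots> = of_real \<alpha> * cayley w z $ 1 + \<beta> * cayley w z $ 2 + \<gamma> + \<i>"
      by (simp add: F[OF z])
    also have "\<dots> = 2 * \<i> / (1 - ?s) * g z"
    proof -
      define k where "k = inverse (1 - ?s)"
      have k: "(1 - ?s) * k = 1" using s by (simp add: k_def)
      have u: "cayley w z $ 1 = 2 * \<i> * k - \<i> * ((1 - ?s) * k)"
        "cayley w z $ 2 = \<i> * perp_coord w z * k"
        by (simp_all add: cayley_def k_def divide_inverse algebra_simps)
      have "2 * \<i> / (1 - ?s) * g z = of_real \<alpha> * (2 * \<i> * k) + \<beta> * (\<i> * perp_coord w z * k)
          + (\<gamma> + \<i> - of_real \<alpha> * \<i>) * ((1 - ?s) * k)"
      proof -
        have "2 * \<i> / (1 - ?s) = 2 * \<i> * k" by (simp add: k_def divide_inverse)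
        then show ?thesis unfolding g_def by (simp add: field_simps)
      qed
      then show ?thesis unfolding u k by (simp add: algebra_simps)
    qed
    finally have "2 * \<i> * (1 - ?s) = 2 * \<i> * (g z * (1 - ?s'))"
      using s by (simp add: field_simps)
    then have g: "1 - ?s = g z * (1 - ?s')"
      by (simp only: mult_cancel_left) simp
    then have "g z \<noteq> 0" using s by auto
    then show ?thesis
      using s z coord_neq_1[OF w]
      by (simp add: R_def siegel_height_cayley[OF w] \<phi> g norm_mult power_mult_distrib)
  qed
  have height: "\<alpha> * siegel_height (cayley w z) \<le> siegel_height (cayley w (\<phi> z))"
    if "norm z < 1" for z
    using ineq[of "cayley w z $ 2"] by (simp add: F[OF that] siegel_height_def algebra_simps)
  have g_lim: "(g \<longlongrightarrow> of_real \<alpha>) (at w within unit_ball)"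
  proof -
    have "(g \<longlongrightarrow> of_real \<alpha> + \<beta> * perp_coord w w / 2
        + (\<gamma> + \<i> - of_real \<alpha> * \<i>) * (1 - coord w w) / (2 * \<i>)) (at w within unit_ball)"
      unfolding g_def by (intro tendsto_intros tendsto_coord) simp_all
    then show ?thesis by (simp add: coord_w[OF w])
  qed
  have radial: "filterlim (\<lambda>r. r *\<^sub>R w) (at w within unit_ball) (at_left (1::real))"
    unfolding filterlim_at
  proof
    have "((\<lambda>r. r *\<^sub>R w) \<longlongrightarrow> 1 *\<^sub>R w) (at_left (1::real))"
      by (intro tendsto_intros)
    then show "((\<lambda>r. r *\<^sub>R w) \<longlongrightarrow> w) (at_left (1::real))" by simp
    have "\<forall>\<^sub>F r in at_left (1::real). r \<in> {0<..<1}"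
      by (rule eventually_at_left_real) simp
    then show "\<forall>\<^sub>F r in at_left (1::real). r *\<^sub>R w \<in> unit_ball \<and> r *\<^sub>R w \<noteq> w"
    proof eventually_elim
      case (elim r)
      then have "norm (r *\<^sub>R w) < 1" "norm (r *\<^sub>R w) \<noteq> norm w" using w by auto
      then show ?case by (metis mem_ball_0)
    qed
  qed
  have nontriv: "at w within unit_ball \<noteq> bot"
  proof
    assume "at w within unit_ball = bot"
    then have "\<forall>\<^sub>F z in at w within unit_ball. False" by simp
    from eventually_compose_filterlim[OF this radial] show False by simp
  qed
  have "1 / \<alpha> \<le> 1"
  proof -
    have "((\<lambda>z. \<alpha> / (cmod (g z))\<^sup>2) \<longlongrightarrow> \<alpha> / (cmod (of_real \<alpha>))\<^sup>2) (at w within unit_ball)"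
      using \<alpha> by (intro tendsto_intros g_lim) simp
    then have "((\<lambda>z. ereal (\<alpha> / (cmod (g z))\<^sup>2)) \<longlongrightarrow> ereal (1 / \<alpha>)) (at w within unit_ball)"
      using \<alpha> by (simp add: power2_eq_square)
    from lim_imp_Liminf[OF nontriv this]
    have "ereal (1 / \<alpha>) = Liminf (at w within unit_ball) (\<lambda>z. ereal (\<alpha> / (cmod (g z))\<^sup>2))" ..
    also have "\<dots> \<le> Liminf (at w within unit_ball) (\<lambda>z. ereal (R z))"
    proof (rule Liminf_mono)
      show "\<forall>\<^sub>F z in at w within unit_ball. ereal (\<alpha> / (cmod (g z))\<^sup>2) \<le> ereal (R z)"
        unfolding eventually_at_filter
      proof (intro always_eventually allI impI)
        fix z :: "complex^2" assume "z \<in> unit_ball"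
        then have z: "norm z < 1" by simp
        then have "0 < siegel_height (cayley w z)"
          using cayley_in_siegel[OF w] siegel_height_pos by blast
        then have "\<alpha> \<le> siegel_height (cayley w (\<phi> z)) / siegel_height (cayley w z)"
          using height[OF z] by (simp add: pos_le_divide_eq)
        then show "ereal (\<alpha> / (cmod (g z))\<^sup>2) \<le> ereal (R z)"
          unfolding R_eq[OF z] ereal_less_eq by (rule divide_right_mono) simp
      qed
    qed
    also have "\<dots> = 1" using dil by (simp add: boundary_dilation_def R_def)
    finally show ?thesis by (simp add: one_ereal_def)
  qed
  \<comment> \<open>A lower limit of 1 bounds \<open>R\<close> below by \<open>y\<close> near
    \<open>w\<close>, in particular along the radius, where \<open>R\<close> tends to
    \<open>1 / \<alpha>\<close>.\<close>
  moreover have "y \<le> 1 / \<alpha>" if "y < 1" for y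
  proof (rule tendsto_lowerbound)
    let ?L = "at_left (1::real)"
    have "Liminf (at w within unit_ball) (\<lambda>z. ereal (R z)) = 1"
      using dil by (simp add: boundary_dilation_def R_def)
    then have "\<forall>x<1. \<forall>\<^sub>F z in at w within unit_ball. x < ereal (R z)"
      using le_Liminf_iff[of 1 "at w within unit_ball" "\<lambda>z. ereal (R z)"] by simp
    moreover have "ereal y < 1" using that by (simp add: one_ereal_def)
    ultimately have "\<forall>\<^sub>F z in at w within unit_ball. ereal y < ereal (R z)" by blast
    then have "\<forall>\<^sub>F z in at w within unit_ball. y < R z" by simp
    from eventually_compose_filterlim[OF this radial]
    show "\<forall>\<^sub>F r in ?L. y \<le> R (r *\<^sub>R w)"
      by eventually_elim simp
    have "\<forall>\<^sub>F r in ?L. r \<in> {0<..<1}"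
      by (rule eventually_at_left_real) simp
    then have ev: "\<forall>\<^sub>F r in ?L. (\<alpha> + (Im \<gamma> - (cmod \<epsilon>)\<^sup>2) * (1 - r) / (1 + r)) / (cmod (g (r *\<^sub>R w)))\<^sup>2
        = R (r *\<^sub>R w)"
    proof eventually_elim
      case (elim r)
      then have r: "0 < r" "r < 1" by auto
      then have z: "norm (r *\<^sub>R w) < 1" using w by simp
      have st: "coord w (r *\<^sub>R w) = of_real r" "perp_coord w (r *\<^sub>R w) = 0"
      proof -
        have "(r *\<^sub>R w) $ i = of_real r * w $ i" for i
          unfolding vector_scaleR_component by (rule scaleR_conv_of_real)
        then have "coord w (r *\<^sub>R w) = of_real r * coord w w"
          "perp_coord w (r *\<^sub>R w) = of_real r * perp_coord w w"
          by (simp_all only: coord_def perp_coord_def) (simp_all add: algebra_simps)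
        then show "coord w (r *\<^sub>R w) = of_real r" "perp_coord w (r *\<^sub>R w) = 0"
          by (simp_all add: coord_w[OF w])
      qed
      have u2: "cayley w (r *\<^sub>R w) $ 2 = 0" by (simp add: cayley_def st)
      have h: "siegel_height (cayley w (r *\<^sub>R w)) = (1 + r) / (1 - r)"
      proof -
        have "cmod (1 - of_real r) = 1 - r"
          using r norm_of_real[of "1 - r", where 'a = complex] by simp
        moreover have "(1 - r\<^sup>2) / (1 - r)\<^sup>2 = (1 + r) / (1 - r)"
        proof -
          have "1 - r\<^sup>2 = (1 + r) * (1 - r)" by (simp add: power2_eq_square algebra_simps)
          then show ?thesis using r by (simp add: power2_eq_square)
        qed
        ultimately show ?thesis
          using siegel_height_cayley[OF w coord_neq_1[OF w z]] w by (simp add: st)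
      qed
      \<comment> \<open>On the radius the second Siegel coordinate is 0, so the height inequality
        becomes an equality up to a constant, negligible as the height tends to infinity.\<close>
      have "siegel_height (cayley w (\<phi> (r *\<^sub>R w))) =
          \<alpha> * siegel_height (cayley w (r *\<^sub>R w)) + (Im \<gamma> - (cmod \<epsilon>)\<^sup>2)"
        by (simp add: F[OF z] siegel_height_def u2)
      then show ?case
        using r unfolding R_eq[OF z] h by (simp add: field_simps)
    qed
    have "((\<lambda>r. (\<alpha> + (Im \<gamma> - (cmod \<epsilon>)\<^sup>2) * (1 - r) / (1 + r)) / (cmod (g (r *\<^sub>R w)))\<^sup>2)
        \<longlongrightarrow> (\<alpha> + (Im \<gamma> - (cmod \<epsilon>)\<^sup>2) * (1 - 1) / (1 + 1)) / (cmod (of_real \<alpha>))\<^sup>2) ?L"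
      using \<alpha> by (intro tendsto_intros filterlim_compose[OF g_lim radial]) simp_all
    then have "((\<lambda>r. R (r *\<^sub>R w)) \<longlongrightarrow> (\<alpha> + (Im \<gamma> - (cmod \<epsilon>)\<^sup>2) * (1 - 1) / (1 + 1)) / (cmod (of_real \<alpha>))\<^sup>2) ?L"
      using tendsto_cong[OF ev] by blast
    then show "((\<lambda>r. R (r *\<^sub>R w)) \<longlongrightarrow> 1 / \<alpha>) ?L"
      using \<alpha> by (simp add: power2_eq_square)
  qed simp
  then have "1 \<le> 1 / \<alpha>" by (rule dense_le)
  ultimately show ?thesis using \<alpha> by (simp add: field_simps)
qed

section \<open>Normal forms\<close>

text \<open>With this constant \<open>psi3\<close> is a Heisenberg translation: the shear adds
  \<open>2 Re (cnj a * u2)\<close> to the imaginary part, exactly the cross term of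
  \<open>|u2 + a|^2\<close>.\<close>

lemma heisenberg_siegel_height:
  "siegel_height (psi3 a (\<i> * of_real ((cmod a)\<^sup>2)) u) = siegel_height u"
  unfolding siegel_height_def psi3_def vector_2 cmod_power2
  by (simp add: power2_eq_square algebra_simps)

lemma heisenberg_inverse:
  "psi3 (- a) (\<i> * of_real ((cmod a)\<^sup>2)) (psi3 a (\<i> * of_real ((cmod a)\<^sup>2)) u) = u"
  unfolding cmod_power2
  by (simp add: psi3_def vec_eq_iff forall_2 complex_eq_iff power2_eq_square algebra_simps)

lemma holomorphic_psi1: "holomorphic_map (psi1 b c l) D"
  unfolding psi1_def by (intro holomorphic_map_vector_2 holomorphic_fun_at_intros)

lemma holomorphic_psi3: "holomorphic_map (psi3 a c) D"
  unfolding psi3_def by (intro holomorphic_map_vector_2 holomorphic_fun_at_intros)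

text \<open>The conjugating map is the Cayley transform followed by a Heisenberg translation;
  \<open>a = 0\<close> gives the Cayley transform alone.\<close>

lemma conjugated_cayley:
  assumes w: "norm w = 1" and \<phi>: "holomorphic_self_map \<phi> unit_ball"
    and \<psi>: "holomorphic_map \<psi> siegel"
    and eq: "\<And>z. norm z < 1 \<Longrightarrow> psi3 a (\<i> * of_real ((cmod a)\<^sup>2)) (cayley w (\<phi> z)) =
      \<psi> (psi3 a (\<i> * of_real ((cmod a)\<^sup>2)) (cayley w z))"
  shows "conjugated \<phi> unit_ball \<psi> siegel"
proof -
  define T where "T = (\<lambda>a. psi3 a (\<i> * of_real ((cmod a)\<^sup>2)))"
  have T_siegel: "T a u \<in> siegel \<longleftrightarrow> u \<in> siegel" for a u
    by (simp only: T_def siegel_height_pos heisenberg_siegel_height)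
  have T_inv: "T (- a) (T a u) = u" "T a (T (- a) u) = u" for u
    using heisenberg_inverse[of a u] heisenberg_inverse[of "- a" u] by (simp_all add: T_def)
  have T_hol: "holomorphic_map (T a) siegel" for a
    by (simp add: T_def holomorphic_psi3)
  show ?thesis
  proof (rule conjugatedI[where \<sigma> = "\<lambda>z. T a (cayley w z)" and \<tau> = "\<lambda>u. cayley_inv w (T (- a) u)"])
    show "holomorphic_map (\<lambda>z. T a (cayley w z)) unit_ball"
      by (rule holomorphic_map_compose[OF holomorphic_cayley[OF w] T_hol])
        (simp add: cayley_in_siegel[OF w])
    show "holomorphic_map (\<lambda>u. cayley_inv w (T (- a) u)) siegel"
      by (rule holomorphic_map_compose[OF T_hol holomorphic_cayley_inv[OF w]])
        (simp add: T_siegel)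
  qed (use \<phi> \<psi> eq in \<open>simp_all add: open_siegel T_siegel T_inv cayley_in_siegel[OF w]
      cayley_inv_in_ball[OF w] cayley_inv_cayley[OF w] cayley_cayley_inv[OF w]\<close>,
      simp add: T_def)
qed

lemma conjugated_inj_on:
  assumes "conjugated \<phi> D \<psi> D'" "inj_on \<phi> D"
  shows "inj_on \<psi> D'"
proof (rule inj_onI)
  from assms(1) obtain \<sigma> where \<sigma>: "bij_betw \<sigma> D D'"
    and \<psi>: "\<psi> ` D' \<subseteq> D'" and eq: "\<And>z. z \<in> D \<Longrightarrow> \<phi> z = inv_into D \<sigma> (\<psi> (\<sigma> z))"
    unfolding conjugated_def biholomorphic_map_def holomorphic_self_map_def by blast
  fix u v assume uv: "u \<in> D'" "v \<in> D'" "\<psi> u = \<psi> v"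
  then obtain x y where "x \<in> D" "y \<in> D" "\<sigma> x = u" "\<sigma> y = v"
    using \<sigma> unfolding bij_betw_def by blast
  with uv eq[of x] eq[of y] assms(2) show "u = v"
    by (metis inj_onD)
qed

lemma psi1_zero_not_inj: "\<not> inj_on (psi1 b c 0) siegel"
proof
  \<comment> \<open>The shift \<open>- 2 * \<i> * b\<close> in the second point cancels the shear
    caused by its second coordinate 1; \<open>y\<close> is large enough to keep that point in the
    half-plane.\<close>
  define y where "y = 2 * cmod b + 2"
  define u v :: "complex^2" where "u = vector [Complex 0 y, 0]"
    and "v = vector [Complex 0 y - 2 * \<i> * b, 1]"
  have "0 < y" "2 * Re b + 1 < y"
    unfolding y_def using complex_Re_le_cmod[of b] norm_ge_zero[of b] by linarith+
  then have "u \<in> siegel" "v \<in> siegel"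
    by (simp_all add: u_def v_def siegel_iff)
  moreover have "psi1 b c 0 u = psi1 b c 0 v" by (simp add: psi1_def u_def v_def)
  moreover have "u \<noteq> v" by (simp add: u_def v_def vec_eq_iff forall_2)
  moreover assume "inj_on (psi1 b c 0) siegel"
  ultimately show False by (meson inj_onD)
qed

text \<open>If the scaling factor were 0, the boundary inequality would force
  \<open>\<beta> = \<delta> = 0\<close>. The map would then be constant, and its value an interior
  fixed point. So the factor is positive, and the dilation coefficient makes it 1.\<close>

lemma parabolic_LFM_affine:
  fixes \<phi> :: "complex^2 \<Rightarrow> complex^2"
  assumes \<phi>: "\<phi> \<in> LFM" and par: "parabolic \<phi>"
  obtains w \<beta> \<gamma> \<delta> \<epsilon> where "norm w = 1"
    "\<And>z. norm z < 1 \<Longrightarrow> cayley w (\<phi> z) =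
      vector [cayley w z $ 1 + \<beta> * cayley w z $ 2 + \<gamma>, \<delta> * cayley w z $ 2 + \<epsilon>]"
    "\<And>v. (cmod (\<delta> * v + \<epsilon>))\<^sup>2 \<le> (cmod v)\<^sup>2 + Im (\<beta> * v + \<gamma>)"
proof -
  from par obtain w where hol: "holomorphic_self_map \<phi> unit_ball"
    and nofix: "\<And>z. norm z < 1 \<Longrightarrow> \<phi> z \<noteq> z"
    and dw: "denjoy_wolff_point \<phi> w" and dil: "boundary_dilation \<phi> w = 1"
    unfolding parabolic_def by auto
  have w: "norm w = 1" using dw by (simp add: denjoy_wolff_point_def)
  have \<phi>_ball: "norm (\<phi> z) < 1" if "norm z < 1" for z
    using hol that unfolding holomorphic_self_map_def by (metis image_subset_iff mem_ball_0)
  obtain \<alpha>' \<beta> \<gamma> \<delta> \<epsilon> where F': "\<And>z. norm z < 1 \<Longrightarrow> cayley w (\<phi> z) =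
      vector [\<alpha>' * cayley w z $ 1 + \<beta> * cayley w z $ 2 + \<gamma>, \<delta> * cayley w z $ 2 + \<epsilon>]"
    using LFM_cayley_affine[OF \<phi> dw] by metis
  have self: "vector [\<alpha>' * u $ 1 + \<beta> * u $ 2 + \<gamma>, \<delta> * u $ 2 + \<epsilon>] \<in> siegel" if u: "u \<in> siegel" for u
    using F'[OF cayley_inv_in_ball[OF w u]] cayley_cayley_inv[OF w u]
      cayley_in_siegel[OF w \<phi>_ball[OF cayley_inv_in_ball[OF w u]]] by simp
  define \<alpha> where "\<alpha> = Re \<alpha>'"
  have \<alpha>: "\<alpha>' = of_real \<alpha>" "0 \<le> \<alpha>"
    using siegel_affine_scale_real[OF self] by (simp_all add: \<alpha>_def)
  note F = F'[unfolded \<alpha>(1)]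
  have ineq: "(cmod (\<delta> * v + \<epsilon>))\<^sup>2 \<le> \<alpha> * (cmod v)\<^sup>2 + Im (\<beta> * v + \<gamma>)" for v
    by (rule siegel_affine_self_map_ineq) (use self \<alpha>(1) in simp)
  have "\<alpha> \<noteq> 0"
  proof
    assume 0: "\<alpha> = 0"
    have "0 \<le> Im (\<beta> * v) + Im \<gamma>" for v
      using order_trans[OF zero_le_power2 ineq[of v]] by (simp add: 0)
    then have \<beta>: "\<beta> = 0" by (rule Im_affine_bounded_below)
    have \<delta>: "\<delta> = 0"
    proof (rule ccontr)
      assume "\<delta> \<noteq> 0"
      have "0 \<le> Im \<gamma>" using order_trans[OF zero_le_power2 ineq[of 0]] by (simp add: 0)
      \<comment> \<open>If \<open>\<delta>\<close> is nonzero,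
        \<open>\<delta> v + \<epsilon>\<close> takes every value, including one with squared modulus
        \<open>Im \<gamma> + 1\<close>, above the allowed bound \<open>Im \<gamma>\<close>.\<close>
      then have "(cmod (of_real (sqrt (Im \<gamma> + 1))))\<^sup>2 = Im \<gamma> + 1"
        by (simp only: norm_of_real power2_abs real_sqrt_pow2)
      moreover have "\<delta> * ((of_real (sqrt (Im \<gamma> + 1)) - \<epsilon>) / \<delta>) + \<epsilon> = of_real (sqrt (Im \<gamma> + 1))"
        using \<open>\<delta> \<noteq> 0\<close> by simp
      ultimately show False
        using ineq[of "(of_real (sqrt (Im \<gamma> + 1)) - \<epsilon>) / \<delta>"] by (simp add: 0 \<beta>)
    qed
    have u: "vector [\<gamma>, \<epsilon>] \<in> siegel"
      using self[of "vector [\<i>, 0]"] by (simp add: siegel_iff \<alpha>(1) 0 \<beta> \<delta>)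
    let ?z = "cayley_inv w (vector [\<gamma>, \<epsilon>])"
    have z: "norm ?z < 1" by (rule cayley_inv_in_ball[OF w u])
    have "cayley w (\<phi> ?z) = vector [\<gamma>, \<epsilon>]" by (simp add: F[OF z] 0 \<beta> \<delta>)
    then have "\<phi> ?z = ?z" using cayley_inv_cayley[OF w \<phi>_ball[OF z]] by simp
    with nofix[OF z] show False by blast
  qed
  with \<alpha>(2) have "\<alpha> = 1"
    using dilation_scale_eq_1[OF w \<phi>_ball F ineq _ dil] by simp
  with that[OF w] F ineq show ?thesis by simp
qed

text \<open>The multiplier \<open>\<delta>\<close> of the second coordinate decides:
  \<open>\<delta> = 1\<close> gives \<open>psi3\<close>. Otherwise the second coordinate has a fixed
  point and the map becomes \<open>psi1\<close>, which reduces to \<open>psi2\<close> when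
  \<open>|\<delta>| = 1\<close>; \<open>\<delta> = 0\<close> is the non-injective case.\<close>

lemma parabolic_LFM_classification:
  fixes \<phi> :: "complex^2 \<Rightarrow> complex^2"
  assumes \<phi>: "\<phi> \<in> LFM" and par: "parabolic \<phi>"
  shows "(\<exists>b c l. 0 < cmod l \<and> cmod l < 1 \<and> conjugated \<phi> unit_ball (psi1 b c l) siegel) \<or>
      (\<exists>c \<theta>. conjugated \<phi> unit_ball (psi2 c \<theta>) siegel) \<or>
      (\<exists>a c. conjugated \<phi> unit_ball (psi3 a c) siegel) \<or>
      (\<not> inj_on \<phi> unit_ball \<and> (\<exists>b c. conjugated \<phi> unit_ball (psi1 b c 0) siegel))"
proof -
  have hol: "holomorphic_self_map \<phi> unit_ball" using par by (simp add: parabolic_def)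
  obtain w \<beta> \<gamma> \<delta> \<epsilon> where w: "norm w = 1"
    and F: "\<And>z. norm z < 1 \<Longrightarrow> cayley w (\<phi> z) =
      vector [cayley w z $ 1 + \<beta> * cayley w z $ 2 + \<gamma>, \<delta> * cayley w z $ 2 + \<epsilon>]"
    and ineq: "\<And>v. (cmod (\<delta> * v + \<epsilon>))\<^sup>2 \<le> (cmod v)\<^sup>2 + Im (\<beta> * v + \<gamma>)"
    using parabolic_LFM_affine[OF \<phi> par] by metis
  have \<delta>1: "cmod \<delta> \<le> 1" by (rule siegel_affine_slope_le_1[OF ineq])
  show ?thesis
  proof (cases "\<delta> = 1")
    case True
    \<comment> \<open>For \<open>\<delta> = 1\<close> the quadratic terms cancel, and the remaining
      linear term must vanish.\<close>
    have "0 \<le> Im ((\<beta> - 2 * \<i> * cnj \<epsilon>) * v) + (Im \<gamma> - (cmod \<epsilon>)\<^sup>2)" for v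
      using ineq[of v] unfolding cmod_power2 True by (simp add: power2_eq_square algebra_simps)
    from Im_affine_bounded_below[OF this] have \<beta>: "\<beta> = 2 * \<i> * cnj \<epsilon>" by simp
    have "conjugated \<phi> unit_ball (psi3 \<epsilon> \<gamma>) siegel"
      by (rule conjugated_cayley[OF w hol holomorphic_psi3, where a = 0])
        (simp add: F psi3_def True \<beta>)
    then show ?thesis by blast
  next
    case False
    text \<open>Translating by the fixed point \<open>p\<close> of the second coordinate removes \<open>\<epsilon>\<close>.\<close>
    define p where "p = \<epsilon> / (1 - \<delta>)"
    \<comment> \<open>The values of \<open>b\<close> and \<open>c\<close> are found by comparing the
      \<open>u2\<close> coefficients and the constants in the conjugacy equation.\<close>
    define b where "b = (\<beta> + 2 * \<i> * cnj p * (1 - \<delta>)) / (2 * \<i>)"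
    define c where "c = \<gamma> + \<beta> * p"
    have p: "\<epsilon> = p * (1 - \<delta>)" using False by (simp add: p_def)
    have conj: "conjugated \<phi> unit_ball (psi1 b c \<delta>) siegel"
    proof (rule conjugated_cayley[OF w hol holomorphic_psi1, where a = "- p"])
      fix z :: "complex^2" assume "norm z < 1"
      have \<beta>: "\<beta> = 2 * \<i> * b - 2 * \<i> * cnj p * (1 - \<delta>)" by (simp add: b_def)
      show "psi3 (- p) (\<i> * of_real ((cmod (- p))\<^sup>2)) (cayley w (\<phi> z)) =
          psi1 b c \<delta> (psi3 (- p) (\<i> * of_real ((cmod (- p))\<^sup>2)) (cayley w z))"
        unfolding psi1_def psi3_def F[OF \<open>norm z < 1\<close>] c_def
        by (simp add: p \<beta> vec_eq_iff forall_2 algebra_simps)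
    qed
    show ?thesis
    proof (cases "cmod \<delta> = 1")
      case True
      have "psi1 b c \<delta> ` siegel \<subseteq> siegel"
        using conj by (simp add: conjugated_def holomorphic_self_map_def)
      then have "vector [of_real 1 * u $ 1 + 2 * \<i> * b * u $ 2 + c, \<delta> * u $ 2 + 0] \<in> siegel"
        if "u \<in> siegel" for u
        using that by (auto simp: psi1_def)
      \<comment> \<open>With \<open>|\<delta>| = 1\<close> and no translation in the second
        coordinate the quadratic terms cancel again, so the shear disappears.\<close>
      from siegel_affine_self_map_ineq[OF this]
      have "0 \<le> Im (2 * \<i> * b * v) + Im c" for v
        by (simp add: norm_mult True)
      then have "2 * \<i> * b = 0" by (rule Im_affine_bounded_below)
      moreover have "\<delta> = exp (\<i> * of_real (Arg \<delta>))"
        using True rcis_cmod_Arg[of \<delta>] by (simp add: rcis_def cis_conv_exp)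
      ultimately have "psi1 b c \<delta> = psi2 c (Arg \<delta>)"
        by (auto simp: psi1_def psi2_def fun_eq_iff)
      with conj show ?thesis by metis
    next
      case False
      with \<delta>1 have less: "cmod \<delta> < 1" by simp
      show ?thesis
      proof (cases "\<delta> = 0")
        case True
        then show ?thesis
          using conj conjugated_inj_on[OF conj] psi1_zero_not_inj by blast
      next
        case False
        then have "0 < cmod \<delta>" by simp
        with less conj show ?thesis by blast
      qed
    qed
  qed
qed

theorem theorem1p11:
  fixes \<phi> :: "complex^2 \<Rightarrow> complex^2"
  assumes "\<phi> \<in> LFM"
    and "parabolic \<phi>"
  shows
    "((\<exists>b c l. 0 < cmod l \<and> cmod l < 1 \<and> conjugated \<phi> unit_ball (psi1 b c l) siegel) \<or>
      (\<exists>c \<theta>. conjugated \<phi> unit_ball (psi2 c \<theta>) siegel) \<or>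
      (\<exists>a c. conjugated \<phi> unit_ball (psi3 a c) siegel) \<or>
      (\<not> inj_on \<phi> unit_ball \<and> (\<exists>b c. conjugated \<phi> unit_ball (psi1 b c 0) siegel))) \<and>
     (\<forall>b c l \<mu> v.
        holomorphic_self_map (psi1 b c l) siegel \<and>
        0 < \<mu> \<and> 0 \<le> v \<and> v < 2 * pi \<and> l = exp (- of_real \<mu> + \<i> * of_real v) \<and>
        Im c \<ge> (cmod b)\<^sup>2 * (\<mu>\<^sup>2 + v\<^sup>2) / (\<mu> * (cmod (1 - l))\<^sup>2)
        \<longrightarrow> embeddable (psi1 b c l) siegel) \<and>
     (\<forall>c \<theta>. holomorphic_self_map (psi2 c \<theta>) siegel \<longrightarrow> embeddable (psi2 c \<theta>) siegel) \<and>
     (\<forall>a c. holomorphic_self_map (psi3 a c) siegel \<longrightarrow> embeddable (psi3 a c) siegel)"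
proof (intro conjI allI impI)
  show "embeddable (psi1 b c l) siegel"
    if "holomorphic_self_map (psi1 b c l) siegel \<and>
        0 < \<mu> \<and> 0 \<le> v \<and> v < 2 * pi \<and> l = exp (- of_real \<mu> + \<i> * of_real v) \<and>
        Im c \<ge> (cmod b)\<^sup>2 * (\<mu>\<^sup>2 + v\<^sup>2) / (\<mu> * (cmod (1 - l))\<^sup>2)" for b c l \<mu> v
    using that by (intro embeddable_psi1[of \<mu> l v]) blast+
qed (rule parabolic_LFM_classification[OF assms] | erule embeddable_psi2 | erule embeddable_psi3)+

end
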